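(* Let $k,m\in\mathbb N$ with $k>6$ and $m\ge2$, and let $l$ be a divisor of $m$ with $1\le l<m$. For each $p\in\bigtriangledown_{m/l}$ let $l_p$ be the minimal number between $1$ and $m/l$ such that $l_p\cdot p\equiv0\pmod{m/l}$. Suppose that $$2l\cdot l_p\ne\frac ml\qquad\text{for all }p\in\bigtriangledown_{m/l}$$ (this holds for example when $m/l$ is odd). Then, up to conjugation, there are exactly $\frac ml+1$ homomorphisms $B_k\to S_{mk}$ among the model homomorphisms $\psi_m$ and $\phi_{m,l,t}$ (for this $m$ and $l$). Explicitly, they are $\psi_m$ together with $\phi_{m,l,t(p)}$ for $p=0,\dots,\frac ml-1$, where $t(p)^i_{(i-1)l+1}=p$ and $t(p)^i_q=0$ for $(i-1)l+1<q\le(i+1)l$, for every $1\le i\le k-1$; that is, these $\frac ml+1$ homomorphisms are pairwise non-conjugate, and each of the model homomorphisms $\psi_m$, $\phi_{m,l,t}$ is conjugate to one of them.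
   Context: $B_k$ is the braid group with generators $\sigma_1,\dots,\sigma_{k-1}$ and relations $\sigma_i\sigma_j=\sigma_j\sigma_i$ for $|i-j|\ge2$ and $\sigma_i\sigma_{i+1}\sigma_i=\sigma_{i+1}\sigma_i\sigma_{i+1}$. $S_n$ is the symmetric group on $\{1,\dots,n\}$ acting from the left, so $(\sigma\tau)(x)=\sigma(\tau(x))$; permutations of a subset are extended by the identity. Homomorphisms $\phi,\psi\colon G\to H$ are conjugate if there is $h\in H$ with $\psi(g)=h^{-1}\phi(g)h$ for all $g\in G$. For $n\ge1$: $\bigtriangledown_n=\{0,\dots,n-1\}$; $|a|_n\in\bigtriangledown_n$ is the residue of $a\in\mathbb Z$ modulo $n$; for $i\ge1$ and $q\in\bigtriangledown_n$ put $a^{(n)}_{i,q}=1+n(i-1)+q$; $A^n_i$ is the $n$-cycle $(1+n(i-1),2+n(i-1),\dots,ni)$ (the identity if $n=1$). For a permutation $\sigma$ of $\{j,\dots,j+r-1\}$ and $t_j,\dots,t_{j+r-1}\in\bigtriangledown_n$, $C^{\sigma,n}_{t_j,\dots,t_{j+r-1}}$ is the permutation of $\{n(j-1)+1,\dots,n(j+r-1)\}$ given by $a^{(n)}_{i,q}\mapsto a^{(n)}_{\sigma(i),\,|q+t_{\sigma(i)}|_n}$ for $j\le i\le j+r-1$, $q\in\bigtriangledown_n$. Model homomorphisms $B_k\to S_{mk}$: For $l\ge1$ and $1\le i\le k-1$, $\psi_l(\sigma_i)\in S_{lk}$ is the $2l$-cycle $(a^{(l)}_{i,0},a^{(l)}_{i+1,0},a^{(l)}_{i,1},a^{(l)}_{i+1,1},\dots,a^{(l)}_{i,l-1},a^{(l)}_{i+1,l-1})$;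 it is also regarded as a permutation of $\{l(i-1)+1,\dots,l(i+1)\}$. This defines $\psi_m\colon B_k\to S_{mk}$. For $l\mid m$, $1\le l<m$, and a family $t=(t^i_q)$, $1\le i\le k-1$, $(i-1)l+1\le q\le(i+1)l$, of elements of $\bigtriangledown_{m/l}$ satisfying, for all $1\le i\le k-2$ and $j\in\bigtriangledown_l$, $$t^i_{(i-1)l+1+|1+j|_l}+t^i_{il+1+|1+j|_l}\equiv t^{i+1}_{(i+1)l+1+j}+t^{i+1}_{il+1+|1+j|_l}\pmod{m/l},$$ the homomorphism $\phi_{m,l,t}\colon B_k\to S_{mk}$ is given by $$\phi_{m,l,t}(\sigma_i)=A^{m/l}_1\cdots A^{m/l}_{(i-1)l}\cdot C^{\psi_l(\sigma_i),m/l}_{t^i_{(i-1)l+1},\dots,t^i_{(i+1)l}}\cdot A^{m/l}_{(i+1)l+1}\cdots A^{m/l}_{kl}.$$ *)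

theory Defs
  imports "HOL-Algebra.Sym_Groups" "HOL-Number_Theory.Cong"
begin

section \<open>The braid group\<close>

text \<open>
  The braid group on \<open>k\<close> strands is the quotient of the set of words in the letters
  \<open>\<sigma>\<^sub>i\<close>, represented as \<open>(i, True)\<close>, and \<open>\<sigma>\<^sub>i\<close> inverse, represented as \<open>(i, False)\<close>,
  where \<open>1 \<le> i \<le> k - 1\<close>, by the least congruence containing free cancellation and
  the braid relations.
\<close>

type_synonym braid_word = "(nat \<times> bool) list"

definition braid_words :: "nat \<Rightarrow> braid_word set" where
  "braid_words k = lists ({1..<k} \<times> UNIV)"

inductive_set braid_cong :: "nat \<Rightarrow> (braid_word \<times> braid_word) set" for k :: nat where
  refl: "w \<in> braid_words k \<Longrightarrow> (w, w) \<in> braid_cong k"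
| sym: "(u, v) \<in> braid_cong k \<Longrightarrow> (v, u) \<in> braid_cong k"
| trans: "(u, v) \<in> braid_cong k \<Longrightarrow> (v, w) \<in> braid_cong k \<Longrightarrow> (u, w) \<in> braid_cong k"
| append: "(u, u') \<in> braid_cong k \<Longrightarrow> (v, v') \<in> braid_cong k \<Longrightarrow> (u @ v, u' @ v') \<in> braid_cong k"
| cancel: "i \<in> {1..<k} \<Longrightarrow> ([(i, b), (i, \<not> b)], []) \<in> braid_cong k"
| commute: "i \<in> {1..<k} \<Longrightarrow> j \<in> {1..<k} \<Longrightarrow> \<bar>int i - int j\<bar> \<ge> 2 \<Longrightarrow>
    ([(i, True), (j, True)], [(j, True), (i, True)]) \<in> braid_cong k"
| braid: "i \<in> {1..<k} \<Longrightarrow> i + 1 \<in> {1..<k} \<Longrightarrow>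
    ([(i, True), (i + 1, True), (i, True)], [(i + 1, True), (i, True), (i + 1, True)]) \<in> braid_cong k"

definition braid_class :: "nat \<Rightarrow> braid_word \<Rightarrow> braid_word set" where
  "braid_class k w = braid_cong k `` {w}"

definition braid_group :: "nat \<Rightarrow> braid_word set monoid" where
  "braid_group k =
    \<lparr> carrier = braid_words k // braid_cong k,
      mult = (\<lambda>X Y. braid_cong k `` {u @ v | u v. u \<in> X \<and> v \<in> Y}),
      one = braid_class k [] \<rparr>"

definition braid_gen :: "nat \<Rightarrow> nat \<Rightarrow> braid_word set" where
  "braid_gen k i = braid_class k [(i, True)]"

lemma braid_words_append [simp]:
  "u @ v \<in> braid_words k \<longleftrightarrow> u \<in> braid_words k \<and> v \<in> braid_words k"
  by (auto simp: braid_words_def)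

lemma braid_words_Nil [simp]: "[] \<in> braid_words k"
  by (simp add: braid_words_def)

lemma braid_words_Cons [simp]:
  "x # w \<in> braid_words k \<longleftrightarrow> fst x \<in> {1..<k} \<and> w \<in> braid_words k"
  by (cases x) (auto simp: braid_words_def)

lemma braid_cong_words:
  assumes "(u, v) \<in> braid_cong k"
  shows "u \<in> braid_words k \<and> v \<in> braid_words k"
  using assms by induction auto

lemma equiv_braid_cong: "equiv (braid_words k) (braid_cong k)"
  by (rule equivI)
    (auto simp: refl_on_def intro!: symI transI dest: braid_cong_words
      intro: braid_cong.refl braid_cong.sym braid_cong.trans)

lemma braid_class_eq_iff:
  assumes "u \<in> braid_words k" "v \<in> braid_words k"
  shows "braid_class k u = braid_class k v \<longleftrightarrow> (u, v) \<in> braid_cong k"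
  using assms eq_equiv_class_iff[OF equiv_braid_cong] by (simp add: braid_class_def)

lemma carrier_braid_group: "carrier (braid_group k) = braid_class k ` braid_words k"
  by (auto simp: braid_group_def quotient_def braid_class_def)

lemma one_braid_group: "\<one>\<^bsub>braid_group k\<^esub> = braid_class k []"
  by (simp add: braid_group_def)

lemma mult_braid_class:
  assumes "u \<in> braid_words k" "v \<in> braid_words k"
  shows "braid_class k u \<otimes>\<^bsub>braid_group k\<^esub> braid_class k v = braid_class k (u @ v)"
proof -
  have "(u @ v, z) \<in> braid_cong k"
    if "(u, u') \<in> braid_cong k" "(v, v') \<in> braid_cong k" "(u' @ v', z) \<in> braid_cong k" for u' v' z
    using that by (blast intro: braid_cong.append braid_cong.trans)
  moreover have "(u, u) \<in> braid_cong k" "(v, v) \<in> braid_cong k"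
    using assms by (auto intro: braid_cong.refl)
  ultimately show ?thesis
    by (fastforce simp: braid_group_def braid_class_def)
qed

lemma braid_cancel_letter: "fst x \<in> {1..<k} \<Longrightarrow> ([(fst x, \<not> snd x), x], []) \<in> braid_cong k"
  using braid_cong.cancel[of "fst x" k "\<not> snd x"] by (cases x) auto

lemma braid_inverse_word:
  assumes "w \<in> braid_words k"
  shows "\<exists>v \<in> braid_words k. (v @ w, []) \<in> braid_cong k"
  using assms
proof (induction w)
  case Nil
  show ?case by (rule bexI[of _ "[]"]) (auto intro: braid_cong.refl)
next
  case (Cons x w)
  then obtain v where v: "v \<in> braid_words k" "(v @ w, []) \<in> braid_cong k" by auto
  have x: "fst x \<in> {1..<k}" and w: "w \<in> braid_words k" using Cons.prems by auto
  have "([(fst x, \<not> snd x), x] @ w, [] @ w) \<in> braid_cong k"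
    by (intro braid_cong.append braid_cancel_letter x braid_cong.refl w)
  then have "(v @ ([(fst x, \<not> snd x), x] @ w), v @ ([] @ w)) \<in> braid_cong k"
    by (rule braid_cong.append[OF braid_cong.refl[OF v(1)]])
  then have "((v @ [(fst x, \<not> snd x)]) @ x # w, []) \<in> braid_cong k"
    using braid_cong.trans v(2) by fastforce
  then show ?case
    by (rule bexI[of _ "v @ [(fst x, \<not> snd x)]"]) (use v x in auto)
qed

lemma group_braid_group: "group (braid_group k)"
proof (rule groupI)
  fix x y z
  assume "x \<in> carrier (braid_group k)" "y \<in> carrier (braid_group k)" "z \<in> carrier (braid_group k)"
  then show "x \<otimes>\<^bsub>braid_group k\<^esub> y \<otimes>\<^bsub>braid_group k\<^esub> z =
      x \<otimes>\<^bsub>braid_group k\<^esub> (y \<otimes>\<^bsub>braid_group k\<^esub> z)"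
    by (auto simp: carrier_braid_group mult_braid_class)
next
  fix x assume "x \<in> carrier (braid_group k)"
  then obtain w where w: "w \<in> braid_words k" "x = braid_class k w"
    by (auto simp: carrier_braid_group)
  then obtain v where v: "v \<in> braid_words k" "(v @ w, []) \<in> braid_cong k"
    using braid_inverse_word by blast
  then have "braid_class k v \<otimes>\<^bsub>braid_group k\<^esub> x = \<one>\<^bsub>braid_group k\<^esub>"
    using w by (simp add: mult_braid_class one_braid_group braid_class_eq_iff)
  then show "\<exists>y\<in>carrier (braid_group k). y \<otimes>\<^bsub>braid_group k\<^esub> x = \<one>\<^bsub>braid_group k\<^esub>"
    using v(1) by (auto simp: carrier_braid_group)
qed (auto simp: carrier_braid_group one_braid_group mult_braid_class)


section \<open>Homomorphisms given by the images of the generators\<close>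

definition braid_relations :: "nat \<Rightarrow> ('a, 'b) monoid_scheme \<Rightarrow> (nat \<Rightarrow> 'a) \<Rightarrow> bool" where
  "braid_relations k G f \<longleftrightarrow>
    (\<forall>i\<in>{1..<k}. f i \<in> carrier G) \<and>
    (\<forall>i\<in>{1..<k}. \<forall>j\<in>{1..<k}. \<bar>int i - int j\<bar> \<ge> 2 \<longrightarrow> f i \<otimes>\<^bsub>G\<^esub> f j = f j \<otimes>\<^bsub>G\<^esub> f i) \<and>
    (\<forall>i\<in>{1..<k}. i + 1 \<in> {1..<k} \<longrightarrow>
      f i \<otimes>\<^bsub>G\<^esub> f (i + 1) \<otimes>\<^bsub>G\<^esub> f i = f (i + 1) \<otimes>\<^bsub>G\<^esub> f i \<otimes>\<^bsub>G\<^esub> f (i + 1))"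

text \<open>
  Extensionality outside the carrier makes the homomorphism unique as a function on the whole
  type; by the lemma \<open>braid_hom_ex1\<close> below, the description is proper whenever the prescribed
  images satisfy the braid relations.
\<close>

definition braid_hom :: "nat \<Rightarrow> ('a, 'b) monoid_scheme \<Rightarrow> (nat \<Rightarrow> 'a) \<Rightarrow> braid_word set \<Rightarrow> 'a" where
  "braid_hom k G f =
    (THE \<phi>. \<phi> \<in> hom (braid_group k) G \<and> \<phi> \<in> extensional (carrier (braid_group k)) \<and>
      (\<forall>i\<in>{1..<k}. \<phi> (braid_gen k i) = f i))"

fun word_eval :: "('a, 'b) monoid_scheme \<Rightarrow> (nat \<Rightarrow> 'a) \<Rightarrow> braid_word \<Rightarrow> 'a" where
  "word_eval G f [] = \<one>\<^bsub>G\<^esub>"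
| "word_eval G f ((i, b) # w) = (if b then f i else inv\<^bsub>G\<^esub> f i) \<otimes>\<^bsub>G\<^esub> word_eval G f w"

context group
begin

lemma word_eval_closed:
  assumes "braid_relations k G f" "w \<in> braid_words k"
  shows "word_eval G f w \<in> carrier G"
  using assms(2)
proof (induction w)
  case (Cons x w)
  then show ?case
    using assms(1) by (cases x) (auto simp: braid_relations_def)
qed auto

lemma word_eval_append:
  assumes "braid_relations k G f" "u \<in> braid_words k" "v \<in> braid_words k"
  shows "word_eval G f (u @ v) = word_eval G f u \<otimes> word_eval G f v"
  using assms(2)
proof (induction u)
  case Nil
  then show ?case using word_eval_closed[OF assms(1,3)] by simp
next
  case (Cons x u)
  then have "fst x \<in> {1..<k}" "u \<in> braid_words k" by auto
  then show ?case
    using Cons.IH assms(1) word_eval_closed[OF assms(1), of u] word_eval_closed[OF assms(1,3)]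
    by (cases x) (auto simp: braid_relations_def m_assoc)
qed

lemma word_eval_cong:
  assumes "braid_relations k G f" "(u, v) \<in> braid_cong k"
  shows "word_eval G f u = word_eval G f v"
  using assms(2)
proof induction
  case (append u u' v v')
  then show ?case
    using word_eval_append[OF assms(1)] braid_cong_words by metis
next
  case (cancel i b)
  then show ?case using assms(1) by (auto simp: braid_relations_def)
next
  case (commute i j)
  then show ?case using assms(1) by (auto simp: braid_relations_def)
next
  case (braid i)
  then show ?case using assms(1) by (auto simp: braid_relations_def m_assoc)
qed auto

lemma braid_hom_eq_word_eval:
  assumes f: "braid_relations k G f"
    and hom: "\<phi> \<in> hom (braid_group k) G" and gen: "\<forall>i\<in>{1..<k}. \<phi> (braid_gen k i) = f i"
    and w: "w \<in> braid_words k"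
  shows "\<phi> (braid_class k w) = word_eval G f w"
proof -
  interpret B: group "braid_group k" by (rule group_braid_group)
  interpret h: group_hom "braid_group k" G \<phi>
    using hom by unfold_locales (simp add: group_hom_axioms_def)
  have letter: "\<phi> (braid_class k [(i, b)]) = (if b then f i else inv f i)"
    if i: "i \<in> {1..<k}" for i b
  proof (cases b)
    case True
    then show ?thesis using gen i by (simp add: braid_gen_def)
  next
    case False
    have "braid_class k [(i, False)] \<otimes>\<^bsub>braid_group k\<^esub> braid_class k [(i, True)] = \<one>\<^bsub>braid_group k\<^esub>"
      using braid_cong.cancel[OF i, of False] i
      by (simp add: mult_braid_class one_braid_group braid_class_eq_iff)
    then have "inv\<^bsub>braid_group k\<^esub> braid_class k [(i, True)] = braid_class k [(i, False)]"
      by (rule B.inv_equality) (use i in \<open>auto simp: carrier_braid_group\<close>)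
    then have "\<phi> (braid_class k [(i, False)]) = \<phi> (inv\<^bsub>braid_group k\<^esub> braid_gen k i)"
      by (simp add: braid_gen_def)
    also have "\<dots> = inv f i"
      using gen i by (subst h.hom_inv) (auto simp: braid_gen_def carrier_braid_group)
    finally show ?thesis using False by simp
  qed
  show ?thesis using w
  proof (induction w)
    case Nil
    then show ?case using h.hom_one by (simp add: one_braid_group)
  next
    case (Cons x w)
    obtain i b where x: "x = (i, b)" by (cases x)
    have i: "i \<in> {1..<k}" and w: "w \<in> braid_words k" using Cons.prems x by auto
    have "braid_class k (x # w) = braid_class k [(i, b)] \<otimes>\<^bsub>braid_group k\<^esub> braid_class k w"
      using i w x by (subst mult_braid_class) auto
    then have "\<phi> (braid_class k (x # w)) = \<phi> (braid_class k [(i, b)]) \<otimes> \<phi> (braid_class k w)"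
      using i w by (auto intro!: h.hom_mult simp: carrier_braid_group)
    then show ?case using letter[OF i] Cons.IH[OF w] x by simp
  qed
qed

lemma braid_hom_ex1:
  assumes f: "braid_relations k G f"
  shows "\<exists>!\<phi>. \<phi> \<in> hom (braid_group k) G \<and> \<phi> \<in> extensional (carrier (braid_group k)) \<and>
    (\<forall>i\<in>{1..<k}. \<phi> (braid_gen k i) = f i)"
proof (rule ex_ex1I)
  define \<phi> where "\<phi> = restrict (\<lambda>X. word_eval G f (SOME w. w \<in> X)) (carrier (braid_group k))"
  have \<phi>: "\<phi> (braid_class k w) = word_eval G f w" if w: "w \<in> braid_words k" for w
  proof -
    have "(SOME v. v \<in> braid_class k w) \<in> braid_class k w"
      by (rule someI[of _ w]) (use w in \<open>auto simp: braid_class_def intro: braid_cong.refl\<close>)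
    then have "word_eval G f (SOME v. v \<in> braid_class k w) = word_eval G f w"
      using word_eval_cong[OF f] by (simp add: braid_class_def)
    then show ?thesis using w by (simp add: \<phi>_def carrier_braid_group)
  qed
  have "\<phi> \<in> hom (braid_group k) G"
    by (rule homI)
      (auto simp: carrier_braid_group mult_braid_class \<phi> word_eval_closed[OF f] word_eval_append[OF f])
  moreover have "\<phi> (braid_gen k i) = f i" if "i \<in> {1..<k}" for i
    using that f by (auto simp: braid_gen_def \<phi> braid_relations_def)
  ultimately show "\<exists>\<phi>. \<phi> \<in> hom (braid_group k) G \<and> \<phi> \<in> extensional (carrier (braid_group k)) \<and>
      (\<forall>i\<in>{1..<k}. \<phi> (braid_gen k i) = f i)"
    by (intro exI[of _ \<phi>]) (auto simp: \<phi>_def)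
next
  fix \<phi> \<phi>'
  assume "\<phi> \<in> hom (braid_group k) G \<and> \<phi> \<in> extensional (carrier (braid_group k)) \<and>
      (\<forall>i\<in>{1..<k}. \<phi> (braid_gen k i) = f i)"
    and "\<phi>' \<in> hom (braid_group k) G \<and> \<phi>' \<in> extensional (carrier (braid_group k)) \<and>
      (\<forall>i\<in>{1..<k}. \<phi>' (braid_gen k i) = f i)"
  then show "\<phi> = \<phi>'"
    by (intro extensionalityI[of \<phi> "carrier (braid_group k)"])
      (auto simp: carrier_braid_group braid_hom_eq_word_eval[OF f])
qed

lemma braid_hom_works:
  assumes "braid_relations k G f"
  shows "braid_hom k G f \<in> hom (braid_group k) G"
    and "braid_hom k G f \<in> extensional (carrier (braid_group k))"
    and "\<And>i. i \<in> {1..<k} \<Longrightarrow> braid_hom k G f (braid_gen k i) = f i"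
  using theI'[OF braid_hom_ex1[OF assms]] by (auto simp: braid_hom_def)

end

definition conj_homs ::
  "('a, 'c) monoid_scheme \<Rightarrow> ('b, 'd) monoid_scheme \<Rightarrow> ('a \<Rightarrow> 'b) \<Rightarrow> ('a \<Rightarrow> 'b) \<Rightarrow> bool" where
  "conj_homs G H \<phi> \<psi> \<longleftrightarrow>
    (\<exists>h\<in>carrier H. \<forall>g\<in>carrier G. \<psi> g = inv\<^bsub>H\<^esub> h \<otimes>\<^bsub>H\<^esub> \<phi> g \<otimes>\<^bsub>H\<^esub> h)"


section \<open>The model homomorphisms\<close>

text \<open>The element \<open>a\<close> with superscript \<open>(n)\<close> and subscript \<open>i,q\<close>; indices \<open>i\<close> start at \<open>1\<close>.\<close>

definition pt :: "nat \<Rightarrow> nat \<Rightarrow> nat \<Rightarrow> nat" where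
  "pt n i q = 1 + n * (i - 1) + q"

text \<open>\<^const>\<open>cycle_of_list\<close> maps every entry of a list to the next one, cyclically.\<close>

definition A_cycle :: "nat \<Rightarrow> nat \<Rightarrow> nat \<Rightarrow> nat" where
  "A_cycle n i = cycle_of_list [1 + n * (i - 1)..<n * i + 1]"

text \<open>
  For \<open>x\<close> between \<open>n (j - 1) + 1\<close> and \<open>n (j + r - 1)\<close> we have \<open>x = pt n i q\<close> exactly for
  \<open>i = (x - 1) div n + 1\<close> and \<open>q = (x - 1) mod n\<close>; here \<open>\<sigma>\<close> permutes \<open>{j..<j + r}\<close>,
  and only the values of \<open>t\<close> on this set matter.
\<close>

definition C_perm :: "nat \<Rightarrow> nat \<Rightarrow> nat \<Rightarrow> (nat \<Rightarrow> nat) \<Rightarrow> (nat \<Rightarrow> nat) \<Rightarrow> nat \<Rightarrow> nat" where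
  "C_perm n j r \<sigma> t x =
    (if x \<in> {n * (j - 1) + 1..n * (j + r - 1)}
     then let i = (x - 1) div n + 1; q = (x - 1) mod n
          in pt n (\<sigma> i) ((q + t (\<sigma> i)) mod n)
     else x)"

lemma C_perm_pt:
  assumes "1 \<le> j" "i \<in> {j..<j + r}" "q < n"
  shows "C_perm n j r \<sigma> t (pt n i q) = pt n (\<sigma> i) ((q + t (\<sigma> i)) mod n)"
proof -
  have "n * (j - 1) \<le> n * (i - 1)" using assms by (intro mult_le_mono2) auto
  moreover have "n * (i - 1) + n = n * i" using assms by (cases i) auto
  moreover have "n * i \<le> n * (j + r - 1)" using assms by (intro mult_le_mono2) auto
  ultimately have "pt n i q \<in> {n * (j - 1) + 1..n * (j + r - 1)}"
    using assms(3) unfolding pt_def atLeastAtMost_iff by linarith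
  moreover have "(pt n i q - 1) div n + 1 = i" "(pt n i q - 1) mod n = q"
    using assms by (auto simp: pt_def)
  ultimately show ?thesis unfolding C_perm_def by (simp add: Let_def)
qed

definition psi_gen :: "nat \<Rightarrow> nat \<Rightarrow> nat \<Rightarrow> nat" where
  "psi_gen l i = cycle_of_list (concat (map (\<lambda>q. [pt l i q, pt l (i + 1) q]) [0..<l]))"

definition psi_hom :: "nat \<Rightarrow> nat \<Rightarrow> braid_word set \<Rightarrow> nat \<Rightarrow> nat" where
  "psi_hom k m = braid_hom k (sym_group (m * k)) (psi_gen m)"

text \<open>A family \<open>t\<close> is encoded as a function with \<open>t i q\<close> for lower index \<open>q\<close> and upper index \<open>i\<close>.\<close>

definition admissible :: "nat \<Rightarrow> nat \<Rightarrow> nat \<Rightarrow> (nat \<Rightarrow> nat \<Rightarrow> nat) \<Rightarrow> bool" where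
  "admissible k m l t \<longleftrightarrow>
    (\<forall>i\<in>{1..k - 1}. \<forall>q\<in>{(i - 1) * l + 1..(i + 1) * l}. t i q < m div l) \<and>
    (\<forall>i\<in>{1..k - 2}. \<forall>j<l.
      [t i ((i - 1) * l + 1 + (1 + j) mod l) + t i (i * l + 1 + (1 + j) mod l)
       = t (i + 1) ((i + 1) * l + 1 + j) + t (i + 1) (i * l + 1 + (1 + j) mod l)] (mod (m div l)))"

definition perm_prod :: "('a \<Rightarrow> 'a) list \<Rightarrow> 'a \<Rightarrow> 'a" where
  "perm_prod ps = foldr (\<circ>) ps id"

definition phi_gen :: "nat \<Rightarrow> nat \<Rightarrow> nat \<Rightarrow> (nat \<Rightarrow> nat \<Rightarrow> nat) \<Rightarrow> nat \<Rightarrow> nat \<Rightarrow> nat" where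
  "phi_gen k m l t i =
    perm_prod (map (A_cycle (m div l)) [1..<(i - 1) * l + 1])
    \<circ> C_perm (m div l) ((i - 1) * l + 1) (2 * l) (psi_gen l i) (t i)
    \<circ> perm_prod (map (A_cycle (m div l)) [(i + 1) * l + 1..<k * l + 1])"

definition phi_hom :: "nat \<Rightarrow> nat \<Rightarrow> nat \<Rightarrow> (nat \<Rightarrow> nat \<Rightarrow> nat) \<Rightarrow> braid_word set \<Rightarrow> nat \<Rightarrow> nat" where
  "phi_hom k m l t = braid_hom k (sym_group (m * k)) (phi_gen k m l t)"

definition model_homs :: "nat \<Rightarrow> nat \<Rightarrow> nat \<Rightarrow> (braid_word set \<Rightarrow> nat \<Rightarrow> nat) set" where
  "model_homs k m l = insert (psi_hom k m) {phi_hom k m l t | t. admissible k m l t}"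

definition t_family :: "nat \<Rightarrow> nat \<Rightarrow> nat \<Rightarrow> nat \<Rightarrow> nat" where
  "t_family l p i q = (if q = (i - 1) * l + 1 then p else 0)"

definition min_mult :: "nat \<Rightarrow> nat \<Rightarrow> nat" where
  "min_mult n p = (LEAST x. 1 \<le> x \<and> x \<le> n \<and> [x * p = 0] (mod n))"

end

theory Submission
  imports Defs
begin

text \<open>
  With \<open>n = m / l\<close>, a point of \<open>{1..m k}\<close> is a cell \<open>(s, j, q)\<close>: strand \<open>s\<close>, block \<open>j\<close> modulo \<open>l\<close> and
  position \<open>q\<close> modulo \<open>n\<close>. The generator \<open>\<sigma>\<^sub>i\<close> acts by \<open>(i, j, q) \<mapsto> (i + 1, j, q + t)\<close>,
  \<open>(i + 1, j, q) \<mapsto> (i, j + 1, q + t)\<close> and \<open>q \<mapsto> q + 1\<close> on the other strands; \<open>\<psi>\<^sub>m\<close> is the case of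
  block size \<open>n = 1\<close>. Rotating the blocks conjugates a family \<open>t\<close> to the normal form \<open>t(p)\<close>, where
  \<open>p\<close> is the total rotation along a cycle of \<open>\<sigma>\<^sub>1\<close>. It is recovered up to conjugacy: the points on
  which all \<open>\<sigma>\<^sub>i\<close> with \<open>i \<ge> 3\<close> agree are those of strands \<open>1\<close> and \<open>2\<close>, and there
  \<open>\<sigma>\<^sub>1\<close> to the power \<open>2 l\<close> equals \<open>\<sigma>\<^sub>3\<close> to the power \<open>p\<close>. Finally \<open>\<psi>\<^sub>m(\<sigma>\<^sub>1)\<close> has fixed points, whereas
  \<open>\<phi>\<^sub>t(\<sigma>\<^sub>1)\<close> has none.
\<close>

section \<open>Cycles and blocks\<close>

text \<open>Mapping the cycle over its own list rotates that list by one place; comparing entries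
  gives the claim.\<close>

lemma cycle_of_list_nth:
  assumes "distinct cs" "i < length cs"
  shows "cycle_of_list cs (cs ! i) = cs ! (Suc i mod length cs)"
proof -
  have "map (cycle_of_list cs) cs = rotate1 cs"
    using cyclic_rotation[OF assms(1), of 1] by simp
  then have "cycle_of_list cs (cs ! i) = rotate1 cs ! i"
    using nth_map[OF assms(2)] by metis
  then show ?thesis using assms(2) by (simp add: nth_rotate1)
qed

text \<open>Division of \<open>pt n i q - 1\<close> by \<open>n\<close> recovers
  \<open>i - 1\<close> and \<open>q\<close>; \<open>1 \<le> i\<close> lets \<open>i - 1\<close>
  determine \<open>i\<close>.\<close>

lemma pt_inject:
  assumes "1 \<le> i" "1 \<le> i'" "q < n" "q' < n"
  shows "pt n i q = pt n i' q' \<longleftrightarrow> i = i' \<and> q = q'"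
proof
  assume eq: "pt n i q = pt n i' q'"
  have "(pt n i q - 1) div n = i - 1" "(pt n i q - 1) mod n = q"
    "(pt n i' q' - 1) div n = i' - 1" "(pt n i' q' - 1) mod n = q'"
    using assms by (auto simp: pt_def)
  then show "i = i' \<and> q = q'" using eq assms by (metis le_add_diff_inverse)
qed auto

lemma pt_cases:
  assumes "0 < n" "x \<in> {1..n * r}"
  obtains i q where "1 \<le> i" "i \<le> r" "q < n" "x = pt n i q"
proof (rule that[of "(x - 1) div n + 1" "(x - 1) mod n"])
  have "(x - 1) div n < r" using assms by (intro less_mult_imp_div_less) (auto simp: mult.commute)
  then show "(x - 1) div n + 1 \<le> r" by simp
  show "x = pt n ((x - 1) div n + 1) ((x - 1) mod n)"
    using assms by (simp add: pt_def)
qed (use assms in auto)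

lemma pt_le:
  assumes "1 \<le> i" "i \<le> r" "q < n"
  shows "pt n i q \<in> {1..n * r}"
proof -
  have "n * (i - 1) + n = n * i" using assms by (cases i) auto
  also have "\<dots> \<le> n * r" using assms by simp
  finally show ?thesis using assms(3) by (simp add: pt_def)
qed

lemma A_cycle_pt:
  assumes "1 \<le> i" "1 \<le> i'" "q < n"
  shows "A_cycle n i (pt n i' q) = (if i = i' then pt n i' (Suc q mod n) else pt n i' q)"
proof -
  define cs where "cs = [1 + n * (i - 1)..<n * i + 1]"
  have A: "A_cycle n i = cycle_of_list cs" unfolding A_cycle_def cs_def ..
  have ni: "n * i = n * (i - 1) + n" using assms by (cases i) auto
  then have len: "length cs = n" by (simp add: cs_def)
  have nth: "cs ! r = pt n i r" if "r < n" for r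
    using that ni by (simp add: cs_def pt_def del: upt_Suc)
  show ?thesis
  proof (cases "i = i'")
    case True
    have "distinct cs" by (simp add: cs_def del: upt_Suc)
    then show ?thesis
      using True A cycle_of_list_nth[of cs q] assms len nth[of q] nth[of "Suc q mod n"]
      by simp
  next
    case False
    have "pt n i' q \<notin> set cs"
    proof
      assume "pt n i' q \<in> set cs"
      then obtain r where "r < n" "pt n i' q = pt n i r"
        using len nth by (metis in_set_conv_nth)
      then show False using False assms pt_inject by blast
    qed
    then show ?thesis using False by (simp add: A id_outside_supp)
  qed
qed

lemma perm_prod_Nil [simp]: "perm_prod [] x = x"
  and perm_prod_Cons [simp]: "perm_prod (f # fs) x = f (perm_prod fs x)"
  by (auto simp: perm_prod_def)

text \<open>As the indices are distinct, at most one factor moves a given block, and the others fix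
  it pointwise.\<close>

lemma perm_prod_A_cycle_pt:
  assumes "distinct is" "\<forall>i\<in>set is. 1 \<le> i" "1 \<le> i'" "q < n"
  shows "perm_prod (map (A_cycle n) is) (pt n i' q) =
    (if i' \<in> set is then pt n i' (Suc q mod n) else pt n i' q)"
  using assms(1,2)
proof (induction "is")
  case (Cons i "is")
  have "(q + 1) mod n < n" using assms(4) by auto
  then show ?case using Cons assms(3,4) by (auto simp: A_cycle_pt)
qed simp

text \<open>The point 0 has no block coordinates, so \<open>phi_gen_outside\<close> treats it
  apart.\<close>

lemma A_cycle_0 [simp]: "A_cycle n i 0 = 0"
  by (simp add: A_cycle_def id_outside_supp del: upt_Suc)

lemma perm_prod_A_cycle_0 [simp]: "perm_prod (map (A_cycle n) is) 0 = 0"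
  by (induction "is") auto

lemma nth_concat_pairs:
  assumes "q < l"
  shows "concat (map (\<lambda>q. [a q, b q]) [0..<l]) ! (2 * q) = a q"
    and "concat (map (\<lambda>q. [a q, b q]) [0..<l]) ! Suc (2 * q) = b q"
proof -
  have len: "length (concat (map (\<lambda>q. [a q, b q]) [0..<r])) = 2 * r" for r
    by (induction r) auto
  have "concat (map (\<lambda>q. [a q, b q]) [0..<l]) ! (2 * q) = a q \<and>
      concat (map (\<lambda>q. [a q, b q]) [0..<l]) ! Suc (2 * q) = b q"
    using assms
  proof (induction l)
    case (Suc l)
    then consider "q < l" | "q = l" by linarith
    then show ?case
      using Suc.IH by cases (auto simp: nth_append len simp del: length_concat)
  qed simp
  then show "concat (map (\<lambda>q. [a q, b q]) [0..<l]) ! (2 * q) = a q"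
    "concat (map (\<lambda>q. [a q, b q]) [0..<l]) ! Suc (2 * q) = b q" by auto
qed

lemma psi_gen_pt:
  assumes i: "1 \<le> i" and j: "j < l"
  shows psi_gen_left: "psi_gen l i (pt l i j) = pt l (Suc i) j"
    and psi_gen_right: "psi_gen l i (pt l (Suc i) j) = pt l i (Suc j mod l)"
    and psi_gen_other: "1 \<le> s \<Longrightarrow> s \<noteq> i \<Longrightarrow> s \<noteq> Suc i \<Longrightarrow> psi_gen l i (pt l s j) = pt l s j"
proof -
  define cs where "cs = concat (map (\<lambda>q. [pt l i q, pt l (Suc i) q]) [0..<l])"
  have "distinct (concat (map (\<lambda>q. [pt l i q, pt l (Suc i) q]) [0..<r]))" if "r \<le> l" for r
    using that i by (induction r) (auto simp: pt_inject)
  then have dist: "distinct cs" by (simp add: cs_def)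
  have "length (concat (map (\<lambda>q. [pt l i q, pt l (Suc i) q]) [0..<r])) = 2 * r" for r
    by (induction r) auto
  then have len: "length cs = 2 * l" by (simp add: cs_def)
  have nth: "cs ! (2 * q) = pt l i q" "cs ! Suc (2 * q) = pt l (Suc i) q" if "q < l" for q
    unfolding cs_def using nth_concat_pairs[OF that] by auto
  have psi: "psi_gen l i = cycle_of_list cs" by (simp add: psi_gen_def cs_def)
  show "psi_gen l i (pt l i j) = pt l (Suc i) j"
    using cycle_of_list_nth[OF dist, of "2 * j"] j len nth[OF j] by (simp add: psi)
  \<comment> \<open>The entry after position \<open>2 * j + 1\<close> is again at an even position,
    so the wrap-around of the long cycle becomes that of \<open>j\<close> modulo
    \<open>l\<close>.\<close>
  have "Suc (Suc (2 * j)) mod (2 * l) = 2 * (Suc j mod l)"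
    by (metis Suc_eq_plus1 add_Suc mult_2 mult_Suc_right mult_mod_right mult_2_right
        numeral_2_eq_2 add_2_eq_Suc)
  moreover have "Suc j mod l < l" using j by auto
  ultimately show "psi_gen l i (pt l (Suc i) j) = pt l i (Suc j mod l)"
    using cycle_of_list_nth[OF dist, of "Suc (2 * j)"] j len nth by (simp add: psi)
  assume "1 \<le> s" "s \<noteq> i" "s \<noteq> Suc i"
  then have "pt l s j \<notin> set cs" using i j by (auto simp: cs_def pt_inject)
  then show "psi_gen l i (pt l s j) = pt l s j" by (simp add: psi id_outside_supp)
qed

lemma psi_gen_outside:
  assumes "1 \<le> i" "i < k" "x \<notin> {1..l * k}"
  shows "psi_gen l i x = x"
proof -
  have "pt l i q \<in> {1..l * k}" "pt l (Suc i) q \<in> {1..l * k}" if "q < l" for q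
    using that assms pt_le[of i k q l] pt_le[of "i + 1" k q l] by auto
  then have "x \<notin> set (concat (map (\<lambda>q. [pt l i q, pt l (Suc i) q]) [0..<l]))"
    using assms(3) by auto
  then show ?thesis by (simp add: psi_gen_def id_outside_supp)
qed

section \<open>The generators on cells\<close>

text \<open>Two levels of blocks: \<open>pt l s j\<close> numbers the blocks of length
  \<open>n\<close>, and \<open>l\<close> consecutive blocks form strand \<open>s\<close>. Strands
  count from 1, \<open>j\<close> and \<open>q\<close> from 0.\<close>

definition cell :: "nat \<Rightarrow> nat \<Rightarrow> nat \<Rightarrow> nat \<Rightarrow> nat \<Rightarrow> nat" where
  "cell n l s j q = pt n (pt l s j) q"

lemma cell_inject:
  assumes "1 \<le> s" "1 \<le> s'" "j < l" "j' < l" "q < n" "q' < n"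
  shows "cell n l s j q = cell n l s' j' q' \<longleftrightarrow> s = s' \<and> j = j' \<and> q = q'"
proof -
  have "1 \<le> pt l s j" "1 \<le> pt l s' j'" by (auto simp: pt_def)
  then show ?thesis using assms by (simp add: cell_def pt_inject)
qed

lemma cell_cases:
  assumes "0 < n" "0 < l" "x \<in> {1..n * l * k}"
  obtains s j q where "1 \<le> s" "s \<le> k" "j < l" "q < n" "x = cell n l s j q"
proof -
  obtain b q where b: "1 \<le> b" "b \<le> l * k" "q < n" "x = pt n b q"
    using pt_cases[of n x "l * k"] assms by (auto simp: mult.assoc)
  obtain s j where "1 \<le> s" "s \<le> k" "j < l" "b = pt l s j"
    using pt_cases[of l b k] assms b by auto
  then show thesis using b that by (auto simp: cell_def)
qed

lemma cell_le:
  assumes "1 \<le> s" "s \<le> k" "j < l" "q < n"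
  shows "cell n l s j q \<in> {1..n * l * k}"
  using pt_le[OF assms(1-3)] pt_le[of "pt l s j" "l * k" q n] assms(4)
  by (auto simp: cell_def mult.assoc)

text \<open>Strand \<open>s\<close> occupies the block indices from \<open>(s - 1) * l + 1\<close>
  to \<open>s * l\<close>. The comparisons decide which factor of \<open>phi_gen\<close> moves a
  given cell.\<close>

lemma pt_in_blocks:
  assumes "1 \<le> s" "j < l"
  shows "a * l + 1 \<le> pt l s j \<longleftrightarrow> a < s" "pt l s j < a * l + 1 \<longleftrightarrow> s \<le> a"
proof -
  have "a * l + 1 \<le> pt l s j \<longleftrightarrow> a < s"
  proof
    assume "a < s"
    then have "a * l \<le> (s - 1) * l" by (intro mult_le_mono1) auto
    then show "a * l + 1 \<le> pt l s j" unfolding pt_def by (metis add.commute add_le_mono mult.commute le_add1 le_trans nat_add_left_cancel_le)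
  next
    assume "a * l + 1 \<le> pt l s j"
    then have "l * a < l * (s - 1) + l" using assms(2) by (simp add: pt_def mult.commute)
    also have "\<dots> = l * s" using assms(1) by (cases s) auto
    finally show "a < s" by simp
  qed
  then show "a * l + 1 \<le> pt l s j \<longleftrightarrow> a < s" "pt l s j < a * l + 1 \<longleftrightarrow> s \<le> a"
    by auto
qed

lemma C_perm_pt_outside:
  assumes "1 \<le> j" "1 \<le> i" "i \<notin> {j..<j + r}" "q < n"
  shows "C_perm n j r \<sigma> t (pt n i q) = pt n i q"
proof -
  have "pt n i q \<notin> {n * (j - 1) + 1..n * (j + r - 1)}"
  proof (cases "i < j")
    case True
    \<comment> \<open>The same comparison one level down, with positions against blocks.\<close>
    then have "\<not> (j - 1) * n + 1 \<le> pt n i q" using pt_in_blocks(1)[of i q n "j - 1"] assms by auto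
    then show ?thesis by (auto simp: mult.commute)
  next
    case False
    then have "\<not> pt n i q < (j + r - 1) * n + 1" using pt_in_blocks(2)[of i q n "j + r - 1"] assms by auto
    then show ?thesis by (auto simp: mult.commute)
  qed
  then show ?thesis unfolding C_perm_def by (rule if_not_P)
qed

text \<open>The three factors act on disjoint sets of strands, so each cell is moved by one factor
  only. On strands \<open>i\<close> and \<open>i + 1\<close> the block follows
  \<open>psi_gen\<close> and the rotation is read off at the target block. Writing \<open>m\<close>
  as \<open>n * l\<close> makes \<open>m div l\<close> equal to \<open>n\<close>.\<close>

lemma phi_gen_cell:
  fixes k l n i :: nat
  assumes i: "1 \<le> i" "i < k" and j: "j < l" and q: "q < n"
  shows phi_gen_left: "phi_gen k (n * l) l t i (cell n l i j q) =
      cell n l (Suc i) j ((q + t i (pt l (Suc i) j)) mod n)"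
    and phi_gen_right: "phi_gen k (n * l) l t i (cell n l (Suc i) j q) =
      cell n l i (Suc j mod l) ((q + t i (pt l i (Suc j mod l))) mod n)"
    and phi_gen_other: "1 \<le> s \<Longrightarrow> s \<le> k \<Longrightarrow> s \<noteq> i \<Longrightarrow> s \<noteq> Suc i \<Longrightarrow>
      phi_gen k (n * l) l t i (cell n l s j q) = cell n l s j (Suc q mod n)"
proof -
  define C where "C = C_perm n ((i - 1) * l + 1) (2 * l) (psi_gen l i) (t i)"
  define L where "L = perm_prod (map (A_cycle n) [1..<(i - 1) * l + 1])"
  have m: "n * l div l = n" using j by simp
  have il: "(i - 1) * l + 2 * l = (i + 1) * l" using i by (cases i) (auto simp: algebra_simps)
  have pos: "1 \<le> pt l s j" for s j by (simp add: pt_def)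
  \<comment> \<open>The factor applied first only advances the strands above \<open>i + 1\<close>,
    up to \<open>k\<close>.\<close>
  have phi: "phi_gen k (n * l) l t i (pt n (pt l s j) q) =
      L (C (if i + 1 < s \<and> s \<le> k then pt n (pt l s j) (Suc q mod n) else pt n (pt l s j) q))"
    if "1 \<le> s" "j < l" "q < n" for s j q
    using that pt_in_blocks[of s j l] pos[of s j]
    by (simp add: phi_gen_def m C_def L_def perm_prod_A_cycle_pt del: upt_Suc)
      (metis Suc_eq_plus1 add.commute mult_Suc plus_1_eq_Suc)
  have low: "L (pt n (pt l s j) q) =
      (if s < i then pt n (pt l s j) (Suc q mod n) else pt n (pt l s j) q)"
    if "1 \<le> s" "j < l" "q < n" for s j q
    using that pt_in_blocks[of s j l] pos[of s j] i
    by (auto simp: L_def perm_prod_A_cycle_pt simp del: upt_Suc)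
  have range: "pt l s j \<in> {(i - 1) * l + 1..<(i - 1) * l + 1 + 2 * l}"
    if "s = i \<or> s = i + 1" "j < l" for s j
  proof -
    have "(i - 1) * l + 1 \<le> pt l s j" "pt l s j < (i + 1) * l + 1"
      using pt_in_blocks(1)[of s j l "i - 1"] pt_in_blocks(2)[of s j l "i + 1"] that i by force+
    then show ?thesis using il by simp
  qed
  have range': "pt l s j \<notin> {(i - 1) * l + 1..<(i - 1) * l + 1 + 2 * l}"
    if "s < i \<or> i + 1 < s" "1 \<le> s" "j < l" for s j
  proof -
    have "\<not> (i - 1) * l + 1 \<le> pt l s j \<or> \<not> pt l s j < (i + 1) * l + 1"
      using pt_in_blocks(1)[of s j l "i - 1"] pt_in_blocks(2)[of s j l "i + 1"] that i by auto
    then show ?thesis using il by auto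
  qed
  have mid: "C (pt n (pt l s j) q) = (let b = psi_gen l i (pt l s j) in pt n b ((q + t i b) mod n))"
    if "s = i \<or> s = i + 1" "j < l" "q < n" for s j q
    unfolding C_def Let_def
    by (rule C_perm_pt[OF _ range]) (use that in auto)
  have out: "C (pt n (pt l s j) q) = pt n (pt l s j) q"
    if "1 \<le> s" "s < i \<or> i + 1 < s" "j < l" "q < n" for s j q
    unfolding C_def
    by (rule C_perm_pt_outside[OF _ pos range']) (use that in auto)
  have lt: "x mod n < n" "x mod l < l" for x using j q by auto
  show "phi_gen k (n * l) l t i (cell n l i j q) =
      cell n l (Suc i) j ((q + t i (pt l (Suc i) j)) mod n)"
    using i j q by (simp add: cell_def phi mid psi_gen_left low lt Let_def)
  show "phi_gen k (n * l) l t i (cell n l (Suc i) j q) =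
      cell n l i (Suc j mod l) ((q + t i (pt l i (Suc j mod l))) mod n)"
    using i j q psi_gen_right[of i j l] by (simp add: cell_def phi mid low lt Let_def)
  assume "1 \<le> s" "s \<le> k" "s \<noteq> i" "s \<noteq> Suc i"
  then show "phi_gen k (n * l) l t i (cell n l s j q) = cell n l s j (Suc q mod n)"
    using i j q by (cases "s < i") (simp_all add: cell_def phi out low lt)
qed

lemma phi_gen_outside:
  fixes k l n i :: nat
  assumes "0 < n" "0 < l" "1 \<le> i" "i < k" "x \<notin> {1..n * l * k}"
  shows "phi_gen k (n * l) l t i x = x"
proof (cases "x = 0")
  case True
  then show ?thesis by (simp add: phi_gen_def C_perm_def del: upt_Suc)
next
  case False
  \<comment> \<open>Every positive \<open>x\<close> has block coordinates: \<open>x\<close> blocks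
    suffice because \<open>x \<le> n * x\<close>. The block index then exceeds \<open>l * k\<close>,
    out of reach of all three factors.\<close>
  obtain b q where b: "1 \<le> b" "q < n" "x = pt n b q"
  proof (rule pt_cases[of n x x])
    show "x \<in> {1..n * x}" using assms(1) False by simp
  qed (use assms(1) that in auto)
  have "\<not> b \<le> l * k" using pt_le[of b "l * k" q n] b assms by (auto simp: mult.assoc)
  moreover have "(i - 1) * l + 2 * l = (i + 1) * l" using assms by (cases i) (auto simp: algebra_simps)
  moreover have "(i + 1) * l \<le> k * l" using assms by (intro mult_le_mono1) auto
  ultimately have "\<not> b < (i - 1) * l + 1 + 2 * l" "\<not> b < (i - 1) * l + 1" "\<not> b < k * l + 1"
    by (auto simp: mult.commute)
  then show ?thesis
    using b assms(2)
    by (simp add: phi_gen_def perm_prod_A_cycle_pt C_perm_pt_outside del: upt_Suc)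
qed

section \<open>Bijectivity of the generators and the braid relations\<close>

lemma mod_add_right_imp_eq:
  fixes q q' n c :: nat
  assumes "(q + c) mod n = (q' + c) mod n" "q < n" "q' < n"
  shows "q = q'"
  using assms by (metis cong_add_rcancel_nat cong_def mod_less)

text \<open>An injective self-map of a finite set. Strands undergo the transposition of
  \<open>i\<close> and \<open>i + 1\<close>, so injectivity is a question within one strand, where
  blocks stay or shift cyclically and positions rotate by an amount that depends on the block
  only.\<close>

lemma phi_gen_permutes:
  assumes n: "0 < n" and l: "0 < l" and i: "1 \<le> i" "i < k"
  shows "phi_gen k (n * l) l t i permutes {1..n * l * k}"
proof (rule inj_imp_permutes)
  let ?f = "phi_gen k (n * l) l t i"
  have lt: "x mod n < n" "x mod l < l" for x using n l by auto
  have strand: "\<exists>j' q'. ?f (cell n l s j q) =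
      cell n l (if s = i then Suc i else if s = Suc i then i else s) j' q' \<and> j' < l \<and> q' < n"
    if s: "1 \<le> s" "s \<le> k" "j < l" "q < n" for s j q
  proof -
    consider "s = i" | "s = Suc i" | "s \<noteq> i" "s \<noteq> Suc i" by blast
    then show ?thesis
    proof cases
      case 1
      show ?thesis
        by (rule exI[of _ j], rule exI[of _ "(q + t i (pt l (Suc i) j)) mod n"])
          (use 1 phi_gen_left[OF i s(3,4), of t] s lt in simp)
    next
      case 2
      show ?thesis
        by (rule exI[of _ "Suc j mod l"], rule exI[of _ "(q + t i (pt l i (Suc j mod l))) mod n"])
          (use 2 phi_gen_right[OF i s(3,4), of t] s lt in simp)
    next
      case 3
      show ?thesis
        by (rule exI[of _ j], rule exI[of _ "Suc q mod n"])
          (use 3 phi_gen_other[OF i s(3,4,1,2), of t] s lt in simp)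
    qed
  qed
  show "inj_on ?f {1..n * l * k}"
  proof (rule inj_onI)
    fix x y assume x: "x \<in> {1..n * l * k}" and y: "y \<in> {1..n * l * k}" and eq: "?f x = ?f y"
    obtain s j q where s: "1 \<le> s" "s \<le> k" "j < l" "q < n" "x = cell n l s j q"
      using cell_cases[OF n l x] by blast
    obtain s' j' q' where s': "1 \<le> s'" "s' \<le> k" "j' < l" "q' < n" "y = cell n l s' j' q'"
      using cell_cases[OF n l y] by blast
    define \<tau> where "\<tau> s = (if s = i then Suc i else if s = Suc i then i else s)" for s
    obtain j1 q1 where 1: "?f x = cell n l (\<tau> s) j1 q1" "j1 < l" "q1 < n"
      using strand[OF s(1-4)] s(5) unfolding \<tau>_def by blast
    obtain j2 q2 where 2: "?f y = cell n l (\<tau> s') j2 q2" "j2 < l" "q2 < n"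
      using strand[OF s'(1-4)] s'(5) unfolding \<tau>_def by blast
    have "1 \<le> \<tau> s" "1 \<le> \<tau> s'" using s s' i by (auto simp: \<tau>_def)
    then have "\<tau> s = \<tau> s'" using 1 2 eq cell_inject[of "\<tau> s" "\<tau> s'" j1 l j2 q1 n q2] by simp
    then have ss: "s' = s" by (auto simp: \<tau>_def split: if_splits)
    have suc: "Suc j mod l = Suc j' mod l \<Longrightarrow> j = j'"
      using mod_add_right_imp_eq[of j 1 l j'] s s' by simp
    note eq' = eq[unfolded s(5) s'(5) ss]
    have "j = j' \<and> q = q'"
    proof -
      consider "s = i" | "s = Suc i" | "s \<noteq> i" "s \<noteq> Suc i" by blast
      then show ?thesis
      proof cases
        case 1
        then show ?thesis
          using eq' i s(3,4) s'(3,4) lt mod_add_right_imp_eq[of q _ n q']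
          by (simp add: phi_gen_left cell_inject) metis
      next
        case 2
        have "Suc j mod l = Suc j' mod l"
          using eq' 2 i s(3,4) s'(3,4) lt by (simp add: phi_gen_right cell_inject)
        then have j: "j' = j" using suc by simp
        have "(q + t i (pt l i (Suc j mod l))) mod n = (q' + t i (pt l i (Suc j mod l))) mod n"
          using eq' 2 i s(3,4) s'(3,4) lt unfolding j by (simp add: phi_gen_right cell_inject)
        then show ?thesis using j mod_add_right_imp_eq s(4) s'(4) by blast
      next
        case 3
        then show ?thesis
          using eq' i s s'(3,4) lt mod_add_right_imp_eq[of q 1 n q']
          by (simp add: phi_gen_other cell_inject)
      qed
    qed
    then show "x = y" using ss s s' by simp
  qed
  show "?f x \<in> {1..n * l * k}" if x: "x \<in> {1..n * l * k}" for x
  proof -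
    obtain s j q where s: "1 \<le> s" "s \<le> k" "j < l" "q < n" "x = cell n l s j q"
      using cell_cases[OF n l x] by blast
    define s' where "s' = (if s = i then Suc i else if s = Suc i then i else s)"
    obtain j' q' where "?f x = cell n l s' j' q'" "j' < l" "q' < n"
      using strand[OF s(1-4)] s(5) unfolding s'_def by blast
    moreover have "1 \<le> s'" "s' \<le> k" using s i by (auto simp: s'_def)
    ultimately show ?thesis using cell_le by presburger
  qed
  show "?f x = x" if "x \<notin> {1..n * l * k}" for x
    by (rule phi_gen_outside) (use that n l i in auto)
qed auto

lemma eq_on_cells:
  assumes "0 < n" "0 < l"
    and "\<And>x. x \<notin> {1..n * l * k} \<Longrightarrow> f x = g x"
    and "\<And>s j q. 1 \<le> s \<Longrightarrow> s \<le> k \<Longrightarrow> j < l \<Longrightarrow> q < n \<Longrightarrow> f (cell n l s j q) = g (cell n l s j q)"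
  shows "f = g"
proof
  fix x show "f x = g x"
  proof (cases "x \<in> {1..n * l * k}")
    case True
    from cell_cases[OF assms(1,2) this] assms(4) show ?thesis by metis
  qed (rule assms(3))
qed

text \<open>At most one of the two generators moves the strand of a given cell. The other merely
  advances the position, and rotations modulo \<open>n\<close> commute.\<close>

lemma phi_gen_commute:
  assumes n: "0 < n" and l: "0 < l" and i: "1 \<le> i" "i < k" and i': "1 \<le> i'" "i' < k"
    and far: "\<bar>int i - int i'\<bar> \<ge> 2"
  shows "phi_gen k (n * l) l t i \<circ> phi_gen k (n * l) l t i' =
    phi_gen k (n * l) l t i' \<circ> phi_gen k (n * l) l t i"
proof (rule eq_on_cells[OF n l])
  show "(phi_gen k (n * l) l t i \<circ> phi_gen k (n * l) l t i') x =
    (phi_gen k (n * l) l t i' \<circ> phi_gen k (n * l) l t i) x" if "x \<notin> {1..n * l * k}" for x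
    using that n l i i' by (simp add: phi_gen_outside)
  fix s j q assume s: "1 \<le> s" "s \<le> k" "j < l" "q < n"
  have lt: "x mod n < n" "x mod l < l" for x using n l by auto
  have ne: "i \<noteq> i'" "i \<noteq> Suc i'" "i' \<noteq> Suc i" using far by auto
  consider "s = i" | "s = Suc i" | "s = i'" | "s = Suc i'"
    | "s \<noteq> i" "s \<noteq> Suc i" "s \<noteq> i'" "s \<noteq> Suc i'" by blast
  then show "(phi_gen k (n * l) l t i \<circ> phi_gen k (n * l) l t i') (cell n l s j q) =
    (phi_gen k (n * l) l t i' \<circ> phi_gen k (n * l) l t i) (cell n l s j q)"
  proof cases
    case 5
    then show ?thesis using s i i' lt by (simp add: phi_gen_other)
  next
    case 1
    then show ?thesis
      using i i' ne s(3,4) by (simp add: phi_gen_left phi_gen_other mod_simps)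
  next
    case 2
    then show ?thesis
      using i i' ne s(3,4) by (simp add: phi_gen_right phi_gen_other mod_simps)
  next
    case 3
    then show ?thesis
      using i i' ne[symmetric] s(3,4) by (simp add: phi_gen_left phi_gen_other mod_simps)
  next
    case 4
    then show ?thesis
      using i i' ne[symmetric] s(3,4) by (simp add: phi_gen_right phi_gen_other mod_simps)
  qed
qed

text \<open>From strands \<open>i\<close> and \<open>i + 2\<close> both sides collect the same
  rotations, and strands away from the three are advanced thrice. Only strand \<open>i + 1\<close>
  gives a condition, which is the hypothesis on \<open>t\<close>.\<close>

lemma phi_gen_braid:
  assumes n: "0 < n" and l: "0 < l" and i: "1 \<le> i" "Suc i < k"
    and t: "\<And>j. j < l \<Longrightarrow> [t i (pt l i (Suc j mod l)) + t i (pt l (Suc i) (Suc j mod l)) =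
      t (Suc i) (pt l (Suc (Suc i)) j) + t (Suc i) (pt l (Suc i) (Suc j mod l))] (mod n)"
  shows "phi_gen k (n * l) l t i \<circ> phi_gen k (n * l) l t (Suc i) \<circ> phi_gen k (n * l) l t i =
    phi_gen k (n * l) l t (Suc i) \<circ> phi_gen k (n * l) l t i \<circ> phi_gen k (n * l) l t (Suc i)"
    (is "?f = ?g")
proof (rule eq_on_cells[OF n l])
  show "?f x = ?g x" if "x \<notin> {1..n * l * k}" for x
    using that n l i by (simp add: phi_gen_outside)
  fix s j q assume s: "1 \<le> s" "s \<le> k" "j < l" "q < n"
  have lt: "x mod n < n" "x mod l < l" for x using n l by auto
  consider "s = i" | "s = Suc i" | "s = Suc (Suc i)"
    | "s \<noteq> i" "s \<noteq> Suc i" "s \<noteq> Suc (Suc i)" by blast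
  then show "?f (cell n l s j q) = ?g (cell n l s j q)"
  proof cases
    case 2
    \<comment> \<open>The left side passes through strand \<open>i\<close>, the right side through
      strand \<open>i + 2\<close>. The \<open>Suc\<close> comes from the middle factor, which only
      advances the cell.\<close>
    have "[Suc q + (t i (pt l i (Suc j mod l)) + t i (pt l (Suc i) (Suc j mod l))) =
      Suc q + (t (Suc i) (pt l (Suc (Suc i)) j) + t (Suc i) (pt l (Suc i) (Suc j mod l)))] (mod n)"
      by (intro cong_add cong_refl t s)
    moreover have "?f (cell n l s j q) = cell n l s (Suc j mod l)
        ((Suc q + (t i (pt l i (Suc j mod l)) + t i (pt l (Suc i) (Suc j mod l)))) mod n)"
      using s(3,4) i lt
      by (simp add: 2 phi_gen_left phi_gen_right phi_gen_other mod_simps add.assoc)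
    moreover have "?g (cell n l s j q) = cell n l s (Suc j mod l)
        ((Suc q + (t (Suc i) (pt l (Suc (Suc i)) j) + t (Suc i) (pt l (Suc i) (Suc j mod l)))) mod n)"
      using s(3,4) i lt
      by (simp add: 2 phi_gen_left phi_gen_right phi_gen_other mod_simps add.assoc)
    ultimately show ?thesis by (simp only: cong_def)
  next
    case 1
    then show ?thesis
      using s(3,4) i lt by (simp add: phi_gen_left phi_gen_right phi_gen_other mod_simps)
  next
    case 3
    then show ?thesis
      using s(3,4) i lt by (simp add: phi_gen_left phi_gen_right phi_gen_other mod_simps add_ac)
  next
    case 4
    then show ?thesis
      using s i lt by (simp add: phi_gen_other)
  qed
qed

lemma admissible_pt:
  assumes "0 < l" "admissible k (n * l) l t" "1 \<le> i" "Suc i < k" "j < l"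
  shows "[t i (pt l i (Suc j mod l)) + t i (pt l (Suc i) (Suc j mod l)) =
      t (Suc i) (pt l (Suc (Suc i)) j) + t (Suc i) (pt l (Suc i) (Suc j mod l))] (mod n)"
proof -
  have "i \<in> {1..k - 2}" using assms by auto
  then show ?thesis
    using assms(1,2,5) by (auto simp: admissible_def pt_def mult.commute add_ac)
qed

lemma braid_relations_phi_gen:
  assumes n: "0 < n" and l: "0 < l" and t: "admissible k (n * l) l t"
  shows "braid_relations k (sym_group (n * l * k)) (phi_gen k (n * l) l t)"
  unfolding braid_relations_def sym_group_carrier sym_group_mult
proof (intro conjI ballI impI)
  fix i assume "i \<in> {1..<k}" "i + 1 \<in> {1..<k}"
  then show "phi_gen k (n * l) l t i \<circ> phi_gen k (n * l) l t (i + 1) \<circ> phi_gen k (n * l) l t i =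
      phi_gen k (n * l) l t (i + 1) \<circ> phi_gen k (n * l) l t i \<circ> phi_gen k (n * l) l t (i + 1)"
    using phi_gen_braid[OF n l _ _ admissible_pt[OF l t, of i]] by simp
qed (use phi_gen_permutes[OF n l] phi_gen_commute[OF n l] in auto)

text \<open>For blocks of length 1 every rotation is trivial and only the block permutation remains.
  The braid relations of \<open>psi_gen\<close> thereby become a case of those of
  \<open>phi_gen\<close>.\<close>

lemma psi_gen_eq_phi_gen:
  assumes "0 < m" "1 \<le> i" "i < k"
  shows "psi_gen m i = phi_gen k m m (\<lambda>_ _. 0) i"
proof (rule eq_on_cells[of 1 m k])
  show "psi_gen m i x = phi_gen k m m (\<lambda>_ _. 0) i x" if "x \<notin> {1..1 * m * k}" for x
    using that assms psi_gen_outside[of i k x m] phi_gen_outside[of 1 m i k x] by simp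
  fix s j q :: nat assume s: "1 \<le> s" "s \<le> k" "j < m" "q < 1"
  have cell: "cell (Suc 0) m s j 0 = pt m s j" for s j by (simp add: cell_def pt_def)
  have q: "q = 0" using s by simp
  consider "s = i" | "s = Suc i" | "s \<noteq> i" "s \<noteq> Suc i" by blast
  then show "psi_gen m i (cell 1 m s j q) = phi_gen k m m (\<lambda>_ _. 0) i (cell 1 m s j q)"
  proof cases
    case 1
    then show ?thesis
      using phi_gen_left[of i k j m 0 1 "\<lambda>_ _. 0"] psi_gen_left[of i j m] s assms
      by (simp add: cell q)
  next
    case 2
    then show ?thesis
      using phi_gen_right[of i k j m 0 1 "\<lambda>_ _. 0"] psi_gen_right[of i j m] s assms
      by (simp add: cell q)
  next
    case 3
    then show ?thesis
      using phi_gen_other[of i k j m 0 1 s "\<lambda>_ _. 0"] psi_gen_other[of i j m s] s assms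
      by (simp add: cell q)
  qed
qed (use assms in auto)

lemma braid_relations_cong:
  assumes "\<And>i. i \<in> {1..<k} \<Longrightarrow> f i = g i" "braid_relations k G g"
  shows "braid_relations k G f"
  using assms by (auto simp: braid_relations_def)

lemma braid_relations_psi_gen:
  assumes "0 < m"
  shows "braid_relations k (sym_group (m * k)) (psi_gen m)"
proof (rule braid_relations_cong)
  show "psi_gen m i = phi_gen k m m (\<lambda>_ _. 0) i" if "i \<in> {1..<k}" for i
    using psi_gen_eq_phi_gen[OF assms] that by auto
  show "braid_relations k (sym_group (m * k)) (phi_gen k m m (\<lambda>_ _. 0))"
    using braid_relations_phi_gen[of 1 m k "\<lambda>_ _. 0"] assms by (simp add: admissible_def)
qed

section \<open>Conjugacy of homomorphisms\<close>

text \<open>A homomorphism is determined on generators, and a conjugate of one is again one. The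
  intertwining form \<open>f i \<otimes> h = h \<otimes> g i\<close> is free of inverses and can be
  checked cell by cell.\<close>

lemma (in group) conj_homs_braid_hom_iff:
  assumes f: "braid_relations k G f" and g: "braid_relations k G g"
  shows "conj_homs (braid_group k) G (braid_hom k G f) (braid_hom k G g) \<longleftrightarrow>
    (\<exists>h\<in>carrier G. \<forall>i\<in>{1..<k}. f i \<otimes> h = h \<otimes> g i)"
proof
  assume "conj_homs (braid_group k) G (braid_hom k G f) (braid_hom k G g)"
  then obtain h where h: "h \<in> carrier G" "\<And>x. x \<in> carrier (braid_group k) \<Longrightarrow>
      braid_hom k G g x = inv h \<otimes> braid_hom k G f x \<otimes> h"
    by (auto simp: conj_homs_def)
  have "f i \<otimes> h = h \<otimes> g i" if i: "i \<in> {1..<k}" for i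
  proof -
    have "braid_gen k i \<in> carrier (braid_group k)"
      using i by (auto simp: braid_gen_def carrier_braid_group)
    then have "g i = inv h \<otimes> f i \<otimes> h"
      using h(2) braid_hom_works(3)[OF f i] braid_hom_works(3)[OF g i] by metis
    moreover have "f i \<in> carrier G" using f i by (auto simp: braid_relations_def)
    ultimately show ?thesis using h(1) by (simp add: m_assoc[symmetric])
  qed
  then show "\<exists>h\<in>carrier G. \<forall>i\<in>{1..<k}. f i \<otimes> h = h \<otimes> g i" using h(1) by blast
next
  assume "\<exists>h\<in>carrier G. \<forall>i\<in>{1..<k}. f i \<otimes> h = h \<otimes> g i"
  then obtain h where h: "h \<in> carrier G" "\<And>i. i \<in> {1..<k} \<Longrightarrow> f i \<otimes> h = h \<otimes> g i" by auto
  \<comment> \<open>This conjugate of the first homomorphism takes the values \<open>g i\<close> on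
    generators, so it and the second one both evaluate words by \<open>g\<close>.\<close>
  define \<phi> where "\<phi> x = inv h \<otimes> braid_hom k G f x \<otimes> h" for x
  have hom: "braid_hom k G f \<in> hom (braid_group k) G" by (rule braid_hom_works(1)[OF f])
  have closed: "braid_hom k G f x \<in> carrier G" if "x \<in> carrier (braid_group k)" for x
    using hom that by (rule hom_in_carrier)
  have "\<phi> \<in> hom (braid_group k) G"
  proof (rule homI)
    fix x y assume "x \<in> carrier (braid_group k)" "y \<in> carrier (braid_group k)"
    then show "\<phi> (x \<otimes>\<^bsub>braid_group k\<^esub> y) = \<phi> x \<otimes> \<phi> y"
      using h(1) closed hom_mult[OF hom, of x y]
      by (simp add: \<phi>_def m_assoc) (simp add: m_assoc[symmetric])
  qed (use h(1) closed in \<open>simp add: \<phi>_def\<close>)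
  moreover have "\<forall>i\<in>{1..<k}. \<phi> (braid_gen k i) = g i"
  proof
    fix i assume i: "i \<in> {1..<k}"
    have "f i \<in> carrier G" "g i \<in> carrier G" using f g i by (auto simp: braid_relations_def)
    then show "\<phi> (braid_gen k i) = g i"
      using h(1) h(2)[OF i] by (simp add: \<phi>_def braid_hom_works(3)[OF f i] m_assoc)
        (simp add: m_assoc[symmetric])
  qed
  ultimately have "\<phi> (braid_class k w) = word_eval G g w" if "w \<in> braid_words k" for w
    using that by (rule braid_hom_eq_word_eval[OF g])
  moreover have "braid_hom k G g (braid_class k w) = word_eval G g w" if "w \<in> braid_words k" for w
    using braid_hom_works(3)[OF g] that by (intro braid_hom_eq_word_eval[OF g braid_hom_works(1)[OF g]]) auto
  ultimately have "\<phi> (braid_class k w) = braid_hom k G g (braid_class k w)" if "w \<in> braid_words k" for w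
    using that by simp
  then show "conj_homs (braid_group k) G (braid_hom k G f) (braid_hom k G g)"
    unfolding conj_homs_def using h(1) by (force simp: carrier_braid_group \<phi>_def)
qed

section \<open>Conjugacy classes and their representatives\<close>

lemma (in group) equiv_conj_homs:
  assumes "S \<subseteq> hom B G"
  shows "equiv S {(\<phi>, \<psi>). \<phi> \<in> S \<and> \<psi> \<in> S \<and> conj_homs B G \<phi> \<psi>}"
proof (rule equivI)
  have closed: "\<phi> g \<in> carrier G" if "\<phi> \<in> S" "g \<in> carrier B" for \<phi> g
    using assms that by (auto simp: hom_def)
  show "refl_on S {(\<phi>, \<psi>). \<phi> \<in> S \<and> \<psi> \<in> S \<and> conj_homs B G \<phi> \<psi>}"
    using closed by (auto simp: refl_on_def conj_homs_def intro!: bexI[of _ \<one>])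
  show "sym {(\<phi>, \<psi>). \<phi> \<in> S \<and> \<psi> \<in> S \<and> conj_homs B G \<phi> \<psi>}"
  proof (rule symI, clarify)
    fix \<phi> \<psi> assume S: "\<phi> \<in> S" "\<psi> \<in> S" and "conj_homs B G \<phi> \<psi>"
    then obtain h where h: "h \<in> carrier G" "\<And>g. g \<in> carrier B \<Longrightarrow> \<psi> g = inv h \<otimes> \<phi> g \<otimes> h"
      by (auto simp: conj_homs_def)
    have "\<phi> g = inv (inv h) \<otimes> \<psi> g \<otimes> inv h" if "g \<in> carrier B" for g
      using h(1) h(2)[OF that] closed[OF S(1) that]
      by (simp add: m_assoc) (simp add: m_assoc[symmetric])
    then show "conj_homs B G \<psi> \<phi>" unfolding conj_homs_def using h(1) by blast
  qed
  show "trans {(\<phi>, \<psi>). \<phi> \<in> S \<and> \<psi> \<in> S \<and> conj_homs B G \<phi> \<psi>}"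
  proof (rule transI, clarify)
    fix \<phi> \<psi> \<chi> assume S: "\<phi> \<in> S" "\<psi> \<in> S" and "conj_homs B G \<phi> \<psi>" "conj_homs B G \<psi> \<chi>"
    then obtain h h' where h: "h \<in> carrier G" "\<And>g. g \<in> carrier B \<Longrightarrow> \<psi> g = inv h \<otimes> \<phi> g \<otimes> h"
      and h': "h' \<in> carrier G" "\<And>g. g \<in> carrier B \<Longrightarrow> \<chi> g = inv h' \<otimes> \<psi> g \<otimes> h'"
      by (auto simp: conj_homs_def)
    have "\<chi> g = inv (h \<otimes> h') \<otimes> \<phi> g \<otimes> (h \<otimes> h')" if "g \<in> carrier B" for g
      using h(1) h'(1) h(2)[OF that] h'(2)[OF that] closed[OF S(1) that]
      by (simp add: inv_mult_group m_assoc)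
    then show "conj_homs B G \<phi> \<chi>" unfolding conj_homs_def using h(1) h'(1) by blast
  qed
qed auto

text \<open>Sending an element to its class is a bijection from \<open>B\<close> onto the
  quotient.\<close>

lemma card_quotient_representatives:
  assumes R: "equiv A R" and B: "B \<subseteq> A"
    and ex: "\<And>x. x \<in> A \<Longrightarrow> \<exists>y\<in>B. (x, y) \<in> R"
    and uniq: "\<And>x y. x \<in> B \<Longrightarrow> y \<in> B \<Longrightarrow> (x, y) \<in> R \<Longrightarrow> x = y"
  shows "card (A // R) = card B"
proof -
  have "A // R = (\<lambda>x. R `` {x}) ` B"
  proof
    show "A // R \<subseteq> (\<lambda>x. R `` {x}) ` B"
      using ex equiv_class_eq[OF R] by (fastforce elim!: quotientE)
    show "(\<lambda>x. R `` {x}) ` B \<subseteq> A // R" using B by (auto intro: quotientI)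
  qed
  moreover have "inj_on (\<lambda>x. R `` {x}) B"
    using uniq B eq_equiv_class[OF _ R] by (blast intro: inj_onI)
  ultimately show ?thesis by (simp add: card_image)
qed

section \<open>Normal forms\<close>

text \<open>The distinguished index is block 0 of strand \<open>i\<close>, so the generator
  \<open>i\<close> rotates by \<open>p\<close> only where it wraps around from the last block to the
  first.\<close>

lemma t_family_pt:
  assumes "1 \<le> i" "1 \<le> s" "j < l"
  shows "t_family l p i (pt l s j) = (if s = i \<and> j = 0 then p else 0)"
proof -
  have "(i - 1) * l + 1 = pt l i 0" by (simp add: pt_def)
  then show ?thesis using assms pt_inject[of s i j l 0] by (simp add: t_family_def)
qed

text \<open>In the congruence \<open>p\<close> enters only through block 0 of the lower strand of a
  generator, that is for \<open>Suc j mod l = 0\<close>, and then once on either side.\<close>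

lemma admissible_t_family:
  assumes "0 < l" "p < n"
  shows "admissible k (n * l) l (t_family l p)"
  unfolding admissible_def
proof (intro conjI ballI allI impI)
  fix i j assume i: "i \<in> {1..k - 2}" and j: "j < l"
  have eqs: "(i - 1) * l + 1 + (1 + j) mod l = pt l i (Suc j mod l)"
    "i * l + 1 + (1 + j) mod l = pt l (Suc i) (Suc j mod l)"
    "(i + 1) * l + 1 + j = pt l (Suc (Suc i)) j"
    by (auto simp: pt_def)
  show "[t_family l p i ((i - 1) * l + 1 + (1 + j) mod l) + t_family l p i (i * l + 1 + (1 + j) mod l) =
      t_family l p (i + 1) ((i + 1) * l + 1 + j) + t_family l p (i + 1) (i * l + 1 + (1 + j) mod l)]
      (mod n * l div l)"
    unfolding eqs using i j by (simp add: t_family_pt)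
qed (use assms in \<open>auto simp: t_family_def\<close>)

text \<open>
  Solving \<open>\<phi>\<^sub>t(\<sigma>\<^sub>i) h = h \<phi>\<^sub>t\<^sub>(\<^sub>p\<^sub>)(\<sigma>\<^sub>i)\<close> for a block-wise rotation \<open>h\<close>: the second sum is forced by the blocks
  of strand \<open>s\<close> going to strand \<open>s + 1\<close> without rotation; the first sum straightens \<open>\<sigma>\<^sub>1\<close>.
\<close>

definition offset :: "nat \<Rightarrow> (nat \<Rightarrow> nat \<Rightarrow> nat) \<Rightarrow> nat \<Rightarrow> nat \<Rightarrow> nat" where
  "offset l t s j = (\<Sum>j'<j. t 1 (pt l 2 j') + t 1 (pt l 1 (Suc j'))) + (\<Sum>i\<in>{1..<s}. t i (pt l (Suc i) j))"

lemma offset_Suc: "1 \<le> s \<Longrightarrow> offset l t (Suc s) j = offset l t s j + t s (pt l (Suc s) j)"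
  by (simp add: offset_def)

text \<open>Modulo \<open>n\<close>, \<open>p\<close> is the sum of \<open>t 1\<close> over all
  blocks of strands 1 and 2. For \<open>i = 1\<close> the sums telescope and the wrap-around leaves
  \<open>p\<close>; in the induction step, admissibility trades the rotations of generator
  \<open>i + 1\<close> for those of generator \<open>i\<close>.\<close>

lemma offset_cong:
  assumes l: "0 < l" and t: "admissible k (n * l) l t" and i: "1 \<le> i" "i < k" and j: "j < l"
    and p: "p = (offset l t 2 (l - 1) + t 1 (pt l 1 0)) mod n"
  shows "[offset l t (Suc i) j + t i (pt l i (Suc j mod l)) =
    offset l t i (Suc j mod l) + (if Suc j mod l = 0 then p else 0)] (mod n)"
  using i
proof (induction i rule: nat_induct_at_least)
  case base
  show ?case
  proof (cases "Suc j = l")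
    case True
    \<comment> \<open>At the wrap-around the offset on the right is that of block 0 of strand 1,
      which is 0, so exactly \<open>p\<close> remains.\<close>
    then have "j = l - 1" by simp
    then show ?thesis using True by (simp add: offset_def p cong_def numeral_2_eq_2)
  next
    case False
    then have "Suc j mod l = Suc j" using j by simp
    then show ?thesis by (simp add: offset_def numeral_2_eq_2 add_ac)
  qed
next
  case (Suc i)
  define e where "e = (if Suc j mod l = 0 then p else 0)"
  have "offset l t (Suc (Suc i)) j + t (Suc i) (pt l (Suc i) (Suc j mod l)) = offset l t (Suc i) j +
      (t (Suc i) (pt l (Suc (Suc i)) j) + t (Suc i) (pt l (Suc i) (Suc j mod l)))"
    by (simp add: offset_Suc)
  also have "[\<dots> = offset l t (Suc i) j +
      (t i (pt l i (Suc j mod l)) + t i (pt l (Suc i) (Suc j mod l)))] (mod n)"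
    using Suc by (intro cong_add cong_refl cong_sym[OF admissible_pt[OF l t _ _ j]]) auto
  also have "offset l t (Suc i) j + (t i (pt l i (Suc j mod l)) + t i (pt l (Suc i) (Suc j mod l))) =
      (offset l t (Suc i) j + t i (pt l i (Suc j mod l))) + t i (pt l (Suc i) (Suc j mod l))" by simp
  also have "[\<dots> = (offset l t i (Suc j mod l) + e) + t i (pt l (Suc i) (Suc j mod l))] (mod n)"
    unfolding e_def by (rule cong_add[OF Suc.IH cong_refl]) (use Suc.prems in simp)
  also have "(offset l t i (Suc j mod l) + e) + t i (pt l (Suc i) (Suc j mod l)) =
      offset l t (Suc i) (Suc j mod l) + e"
    using Suc by (simp add: offset_Suc)
  finally show ?case by (simp add: e_def)
qed

section \<open>Conjugation to the normal form by block-wise rotations\<close>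

lemma rotation_cell:
  assumes "1 \<le> s" "s \<le> k" "j < l" "q < n"
  shows "C_perm n 1 (l * k) id H (cell n l s j q) = cell n l s j ((q + H (pt l s j)) mod n)"
  using C_perm_pt[of 1 "pt l s j" "l * k" q n id H] pt_le[OF assms(1-3)] assms(4)
  by (simp add: cell_def)

lemma rotation_outside:
  "x \<notin> {1..n * l * k} \<Longrightarrow> C_perm n 1 (l * k) id H x = x"
  by (auto simp: C_perm_def mult.assoc)

lemma rotation_permutes:
  assumes n: "0 < n" and l: "0 < l"
  shows "C_perm n 1 (l * k) id H permutes {1..n * l * k}"
proof (rule inj_imp_permutes)
  have lt: "x mod n < n" for x using n by auto
  show "inj_on (C_perm n 1 (l * k) id H) {1..n * l * k}"
  proof (rule inj_onI)
    fix x y assume x: "x \<in> {1..n * l * k}" and y: "y \<in> {1..n * l * k}"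
      and eq: "C_perm n 1 (l * k) id H x = C_perm n 1 (l * k) id H y"
    obtain s j q where s: "1 \<le> s" "s \<le> k" "j < l" "q < n" "x = cell n l s j q"
      using cell_cases[OF n l x] by blast
    obtain s' j' q' where s': "1 \<le> s'" "s' \<le> k" "j' < l" "q' < n" "y = cell n l s' j' q'"
      using cell_cases[OF n l y] by blast
    have "cell n l s j ((q + H (pt l s j)) mod n) = cell n l s' j' ((q' + H (pt l s' j')) mod n)"
      using eq rotation_cell[OF s(1-4)] rotation_cell[OF s'(1-4)] s(5) s'(5) by metis
    then have "s = s' \<and> j = j' \<and> (q + H (pt l s j)) mod n = (q' + H (pt l s' j')) mod n"
      using cell_inject[OF s(1) s'(1) s(3) s'(3) lt lt] by blast
    then show "x = y" using mod_add_right_imp_eq[of q "H (pt l s j)" n q'] s s' by metis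
  qed
  show "C_perm n 1 (l * k) id H x \<in> {1..n * l * k}" if x: "x \<in> {1..n * l * k}" for x
  proof -
    obtain s j q where s: "1 \<le> s" "s \<le> k" "j < l" "q < n" "x = cell n l s j q"
      using cell_cases[OF n l x] by blast
    then show ?thesis using rotation_cell[OF s(1-4)] cell_le[OF s(1-3) lt] by simp
  qed
qed (rule finite_atLeastAtMost, rule rotation_outside)

text \<open>Intertwining is one condition per kind of cell: \<open>offset_Suc\<close> settles strand
  \<open>i\<close>, \<open>offset_cong\<close> settles strand \<open>i + 1\<close>, and on the other
  strands both maps rotate positions and commute.\<close>

lemma phi_gen_conj_t_family:
  assumes n: "0 < n" and l: "0 < l" and t: "admissible k (n * l) l t"
  shows "\<exists>p<n. \<exists>h. h permutes {1..n * l * k} \<and>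
    (\<forall>i\<in>{1..<k}. phi_gen k (n * l) l t i \<circ> h = h \<circ> phi_gen k (n * l) l (t_family l p) i)"
proof -
  define p where "p = (offset l t 2 (l - 1) + t 1 (pt l 1 0)) mod n"
  \<comment> \<open>\<open>C_perm\<close> indexes its rotations by blocks, so strand and block are
    recovered from \<open>b\<close> by division.\<close>
  define H where "H b = offset l t ((b - 1) div l + 1) ((b - 1) mod l)" for b
  have H: "H (pt l s j) = offset l t s j" if "1 \<le> s" "j < l" for s j
    using that by (simp add: H_def pt_def)
  define h where "h = C_perm n 1 (l * k) id H"
  have h: "h (cell n l s j q) = cell n l s j ((q + offset l t s j) mod n)"
    if "1 \<le> s" "s \<le> k" "j < l" "q < n" for s j q
    unfolding h_def rotation_cell[OF that] using that by (simp add: H)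
  have p': "p < n" using n by (simp add: p_def)
  have lt: "x mod n < n" "x mod l < l" for x using n l by auto
  have "phi_gen k (n * l) l t i \<circ> h = h \<circ> phi_gen k (n * l) l (t_family l p) i"
    if "i \<in> {1..<k}" for i
  proof (rule eq_on_cells[OF n l])
    have i: "1 \<le> i" "i < k" using that by auto
    show "(phi_gen k (n * l) l t i \<circ> h) x = (h \<circ> phi_gen k (n * l) l (t_family l p) i) x"
      if "x \<notin> {1..n * l * k}" for x
      using that n l i rotation_outside[OF that] unfolding h_def by (simp add: phi_gen_outside)
    fix s j q assume s: "1 \<le> s" "s \<le> k" "j < l" "q < n"
    consider "s = i" | "s = Suc i" | "s \<noteq> i" "s \<noteq> Suc i" by blast
    then show "(phi_gen k (n * l) l t i \<circ> h) (cell n l s j q) =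
        (h \<circ> phi_gen k (n * l) l (t_family l p) i) (cell n l s j q)"
    proof cases
      case 1
      then show ?thesis
        using s(3,4) i by (simp add: h phi_gen_left t_family_pt offset_Suc mod_simps add_ac)
    next
      case 2
      define e where "e = (if Suc j mod l = 0 then p else 0)"
      have "(phi_gen k (n * l) l t i \<circ> h) (cell n l s j q) = cell n l i (Suc j mod l)
          ((q + (offset l t (Suc i) j + t i (pt l i (Suc j mod l)))) mod n)"
        using s(3,4) i by (simp add: 2 h phi_gen_right mod_simps add.assoc)
      moreover have "(h \<circ> phi_gen k (n * l) l (t_family l p) i) (cell n l s j q) =
          cell n l i (Suc j mod l) ((q + (offset l t i (Suc j mod l) + e)) mod n)"
        using s(3,4) i lt by (simp add: 2 h phi_gen_right t_family_pt e_def mod_simps add_ac)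
      moreover have "[q + (offset l t (Suc i) j + t i (pt l i (Suc j mod l))) =
          q + (offset l t i (Suc j mod l) + e)] (mod n)"
        unfolding e_def by (intro cong_add cong_refl offset_cong[OF l t i s(3) p_def])
      ultimately show ?thesis by (simp only: cong_def)
    next
      case 3
      then show ?thesis using s i lt by (simp add: h phi_gen_other mod_simps)
    qed
  qed
  moreover have "h permutes {1..n * l * k}" unfolding h_def by (rule rotation_permutes[OF n l])
  ultimately show ?thesis using p' by blast
qed

section \<open>Invariants\<close>

lemma semiconj_funpow:
  assumes "f \<circ> h = h \<circ> g"
  shows "(f ^^ r) (h x) = h ((g ^^ r) x)"
  by (induction r) (use assms in \<open>auto simp: fun_eq_iff\<close>)

lemma phi_gen_other_funpow:
  assumes "1 \<le> i" "i < k" "1 \<le> s" "s \<le> k" "s \<noteq> i" "s \<noteq> Suc i" "j < l" "q < n"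
  shows "(phi_gen k (n * l) l t i ^^ r) (cell n l s j q) = cell n l s j ((q + r) mod n)"
  by (induction r) (use assms in \<open>auto simp: phi_gen_other mod_simps\<close>)

text \<open>Two applications move a cell one block further on its strand and add \<open>p\<close> on
  entering block 0. After \<open>2 * l\<close> applications the block is restored and block 0 has
  been entered exactly once.\<close>

lemma phi_gen_t_family_funpow:
  assumes i: "1 \<le> i" "i < k" and s: "s = i \<or> s = Suc i" and j: "j < l" and q: "q < n"
  shows "(phi_gen k (n * l) l (t_family l p) i ^^ (2 * l)) (cell n l s j q) = cell n l s j ((q + p) mod n)"
proof -
  define f where "f = phi_gen k (n * l) l (t_family l p) i"
  have two: "f (f (cell n l s j q)) =
      cell n l s (Suc j mod l) ((q + (if Suc j mod l = 0 then p else 0)) mod n)"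
    if "j < l" "q < n" for j q
    using s
  proof
    assume "s = i"
    then show ?thesis using that i by (simp add: f_def phi_gen_left phi_gen_right t_family_pt)
  next
    have "Suc j mod l < l" using that by simp
    moreover assume "s = Suc i"
    ultimately show ?thesis using that i by (simp add: f_def phi_gen_left phi_gen_right t_family_pt)
  qed
  \<comment> \<open>The entries into block 0 during \<open>r\<close> double steps are counted by
    \<open>(j + r) div l\<close>.\<close>
  have iter: "((f ^^ 2) ^^ r) (cell n l s j q) = cell n l s ((j + r) mod l) ((q + p * ((j + r) div l)) mod n)" for r
  proof (induction r)
    case 0
    then show ?case using j q by simp
  next
    case (Suc r)
    have "((f ^^ 2) ^^ Suc r) (cell n l s j q) =
        (f ^^ 2) (cell n l s ((j + r) mod l) ((q + p * ((j + r) div l)) mod n))"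
      by (simp add: Suc)
    also have "\<dots> = f (f (cell n l s ((j + r) mod l) ((q + p * ((j + r) div l)) mod n)))"
      by (simp add: numeral_2_eq_2)
    also have "\<dots> = cell n l s (Suc (j + r) mod l)
        ((q + p * ((j + r) div l) + (if Suc (j + r) mod l = 0 then p else 0)) mod n)"
      using j q by (subst two) (simp_all add: mod_simps)
    also have "q + p * ((j + r) div l) + (if Suc (j + r) mod l = 0 then p else 0) =
        q + p * (Suc (j + r) div l)"
      by (simp add: div_Suc)
    finally show ?case by simp
  qed
  have "(j + l) mod l = j" "(j + l) div l = 1"
    using j div_add_self2[of l j] by auto
  then show ?thesis using iter[of l] by (simp add: funpow_mult f_def)
qed

lemma phi_gen_t_family_conj_imp_eq:
  assumes k: "k > 6" and n: "0 < n" and l: "0 < l" and p: "p < n" "p' < n"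
    and h: "h permutes {1..n * l * k}"
    and conj: "\<And>i. i \<in> {1..<k} \<Longrightarrow>
      phi_gen k (n * l) l (t_family l p) i \<circ> h = h \<circ> phi_gen k (n * l) l (t_family l p') i"
  shows "p = p'"
proof -
  define f where "f i = phi_gen k (n * l) l (t_family l p) i" for i
  define g where "g i = phi_gen k (n * l) l (t_family l p') i" for i
  have conj: "f i \<circ> h = h \<circ> g i" if "i \<in> {1..<k}" for i
    using conj[OF that] by (simp add: f_def g_def)
  define x where "x = cell n l 1 0 0"
  have lt: "y mod n < n" "y mod l < l" for y using n l by auto
  have "h x \<in> {1..n * l * k}"
    using cell_le[of 1 k 0 l 0 n] k n l permutes_in_image[OF h] by (simp add: x_def)
  then obtain s j q where s: "1 \<le> s" "s \<le> k" "j < l" "q < n" "h x = cell n l s j q"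
    using cell_cases[OF n l] by blast
  \<comment> \<open>All \<open>g i\<close> with \<open>i \<ge> 3\<close> advance \<open>x\<close>,
    which lies on strand 1, in the same way; intertwining carries this over to the
    \<open>f i\<close> at \<open>h x\<close>.\<close>
  have agree: "f i (h x) = h (cell n l 1 0 (1 mod n))" if "i \<in> {3..<k}" for i
    using fun_cong[OF conj[of i], of x] that phi_gen_other[of i k 0 l 0 n 1 "t_family l p'"] n l
    by (simp add: g_def x_def)
  \<comment> \<open>On strands \<open>1\<close> and \<open>2\<close> all \<open>f i\<close> with \<open>i \<ge> 3\<close> coincide; any other strand is moved by some of
    them and preserved by others.\<close>
  have "s < 3"
  proof (rule ccontr)
    assume "\<not> s < 3"
    \<comment> \<open>\<open>a\<close> moves strand \<open>s\<close>; the last strand is moved by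
      the last generator \<open>k - 1\<close> only. \<open>b\<close> avoids strand \<open>s\<close>:
      5 serves for strands 3 and 4, and 3 for all later ones.\<close>
    define a where "a = (if s = k then k - 1 else s)"
    define b where "b = (if s < 5 then 5 else 3 :: nat)"
    have a: "a \<in> {3..<k}" "s = a \<or> s = Suc a" and b: "b \<in> {3..<k}" "s \<noteq> b" "s \<noteq> Suc b"
      using \<open>\<not> s < 3\<close> s(2) k by (auto simp: a_def b_def)
    have "\<exists>s' j' q'. f a (cell n l s j q) = cell n l s' j' q' \<and> 1 \<le> s' \<and> s' \<noteq> s \<and> j' < l \<and> q' < n"
      using a(2)
    proof
      assume "s = a"
      then show ?thesis
        using phi_gen_left[of a k j l q n "t_family l p"] a(1) s(3,4) lt
        by (intro exI[of _ "Suc a"] exI) (auto simp: f_def)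
    next
      assume "s = Suc a"
      then show ?thesis
        using phi_gen_right[of a k j l q n "t_family l p"] a(1) s(3,4) lt
        by (intro exI[of _ a] exI) (auto simp: f_def)
    qed
    moreover have "f b (cell n l s j q) = cell n l s j (Suc q mod n)"
      using b s phi_gen_other[of b k j l q n s] by (simp add: f_def)
    moreover have "f a (cell n l s j q) = f b (cell n l s j q)"
      using agree[OF a(1)] agree[OF b(1)] s(5) by simp
    ultimately show False using s(1,3) lt cell_inject by metis
  qed
  then have s': "s = 1 \<or> s = Suc 1" using s(1) by auto
  \<comment> \<open>At \<open>h x\<close> the maps \<open>f 1 ^^ (2 * l)\<close> and
    \<open>f 3 ^^ p\<close> agree; pulled back by \<open>h\<close>, this compares the shifts
    \<open>p'\<close> and \<open>p\<close> of \<open>x\<close>.\<close>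
  have "h ((g 1 ^^ (2 * l)) x) = (f 1 ^^ (2 * l)) (h x)"
    using semiconj_funpow[OF conj[of 1]] k by simp
  also have "\<dots> = cell n l s j ((q + p) mod n)"
    using phi_gen_t_family_funpow[of 1 k s j l q n p] s' s k by (simp add: f_def)
  also have "\<dots> = (f 3 ^^ p) (h x)"
    using phi_gen_other_funpow[of 3 k s j l q n] s' s k by (auto simp: f_def)
  also have "\<dots> = h ((g 3 ^^ p) x)"
    using semiconj_funpow[OF conj[of 3]] k by simp
  finally have "(g 1 ^^ (2 * l)) x = (g 3 ^^ p) x"
    using permutes_inj[OF h] by (simp add: inj_eq)
  moreover have "(g 1 ^^ (2 * l)) x = cell n l 1 0 p'"
    using phi_gen_t_family_funpow[of 1 k 1 0 l 0 n p'] p n l k by (simp add: g_def x_def)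
  moreover have "(g 3 ^^ p) x = cell n l 1 0 p"
    using phi_gen_other_funpow[of 3 k 1 0 l 0 n p] p n l k by (simp add: g_def x_def)
  ultimately show ?thesis using cell_inject[of 1 1 0 l 0 p n p'] p l by simp
qed

text \<open>A generator exchanges strands \<open>i\<close> and \<open>i + 1\<close> and advances the
  positions of all others by one, which moves them because \<open>n \<ge> 2\<close>.\<close>

lemma phi_gen_no_fixpoint:
  assumes n: "2 \<le> n" and l: "0 < l" and i: "1 \<le> i" "i < k" and x: "x \<in> {1..n * l * k}"
  shows "phi_gen k (n * l) l t i x \<noteq> x"
proof -
  have n0: "0 < n" using n by simp
  have lt: "y mod n < n" "y mod l < l" for y using n0 l by auto
  obtain s j q where s: "1 \<le> s" "s \<le> k" "j < l" "q < n" "x = cell n l s j q"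
    using cell_cases[OF n0 l x] by blast
  consider "s = i" | "s = Suc i" | "s \<noteq> i" "s \<noteq> Suc i" by blast
  then show ?thesis
  proof cases
    case 1
    then show ?thesis using s(3-5) i lt by (simp add: phi_gen_left cell_inject)
  next
    case 2
    then show ?thesis using s(3-5) i lt by (simp add: phi_gen_right cell_inject)
  next
    case 3
    have "Suc q mod n \<noteq> q" using n s(4) by (simp add: mod_Suc)
    then show ?thesis using 3 s i lt by (simp add: phi_gen_other cell_inject)
  qed
qed

lemma psi_gen_phi_gen_not_conj:
  assumes k: "3 \<le> k" and n: "2 \<le> n" and l: "0 < l" and h: "h permutes {1..n * l * k}"
  shows "psi_gen (n * l) 1 \<circ> h \<noteq> h \<circ> phi_gen k (n * l) l t 1"
proof
  assume eq: "psi_gen (n * l) 1 \<circ> h = h \<circ> phi_gen k (n * l) l t 1"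
  \<comment> \<open>Strand 3 is fixed pointwise by \<open>psi_gen (n * l) 1\<close>; the preimage of
    \<open>y\<close> under \<open>h\<close> would be a fixed point of the other generator.\<close>
  define y where "y = pt (n * l) 3 0"
  have y: "psi_gen (n * l) 1 y = y" "y \<in> {1..n * l * k}"
    using psi_gen_other[of 1 0 "n * l" 3] pt_le[of 3 k 0 "n * l"] n l k by (auto simp: y_def)
  obtain x where x: "x \<in> {1..n * l * k}" "h x = y"
    using permutes_image[OF h] y(2) by (metis imageE)
  have "h (phi_gen k (n * l) l t 1 x) = h x" using fun_cong[OF eq, of x] x y by simp
  then have "phi_gen k (n * l) l t 1 x = x" using permutes_inj[OF h] by (simp add: inj_eq)
  then show False using phi_gen_no_fixpoint[OF n l _ _ x(1)] k by simp
qed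

text \<open>As \<open>braid_hom\<close> is a definite description, the first conjuncts record that
  the model homomorphisms are homomorphisms with the prescribed values. The number up to conjugation
  is the size of a quotient.\<close>

theorem proposition3p25:
  fixes k m l :: nat
  assumes "k > 6" and "m \<ge> 2" and "l dvd m" and "1 \<le> l" and "l < m"
  shows
    "psi_hom k m \<in> hom (braid_group k) (sym_group (m * k)) \<and>
     (\<forall>i\<in>{1..k - 1}. psi_hom k m (braid_gen k i) = psi_gen m i) \<and>
     (\<forall>t. admissible k m l t \<longrightarrow>
        phi_hom k m l t \<in> hom (braid_group k) (sym_group (m * k)) \<and>
        (\<forall>i\<in>{1..k - 1}. phi_hom k m l t (braid_gen k i) = phi_gen k m l t i)) \<and>
     (odd (m div l) \<longrightarrow> (\<forall>p<m div l. 2 * l * min_mult (m div l) p \<noteq> m div l)) \<and>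
     ((\<forall>p<m div l. 2 * l * min_mult (m div l) p \<noteq> m div l) \<longrightarrow>
        card (model_homs k m l //
            {(\<phi>, \<psi>). \<phi> \<in> model_homs k m l \<and> \<psi> \<in> model_homs k m l \<and>
                      conj_homs (braid_group k) (sym_group (m * k)) \<phi> \<psi>})
          = m div l + 1 \<and>
        (\<forall>p<m div l. admissible k m l (t_family l p)) \<and>
        (\<forall>p<m div l. \<not> conj_homs (braid_group k) (sym_group (m * k))
                          (psi_hom k m) (phi_hom k m l (t_family l p))) \<and>
        (\<forall>p<m div l. \<forall>p'<m div l. p \<noteq> p' \<longrightarrow>
           \<not> conj_homs (braid_group k) (sym_group (m * k))
                (phi_hom k m l (t_family l p)) (phi_hom k m l (t_family l p'))) \<and>
        (\<forall>\<phi>\<in>model_homs k m l.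
           conj_homs (braid_group k) (sym_group (m * k)) \<phi> (psi_hom k m) \<or>
           (\<exists>p<m div l. conj_homs (braid_group k) (sym_group (m * k))
                           \<phi> (phi_hom k m l (t_family l p)))))"
proof -
  define n where "n = m div l"
  have m: "m = n * l" using assms(3) by (simp add: n_def)
  have l: "0 < l" using assms by simp
  \<comment> \<open>The strict inequality \<open>l < m\<close> gives \<open>n \<ge> 2\<close>, on
    which the absence of fixed points rests.\<close>
  have "1 * l < n * l" using assms(5) m by simp
  then have "1 < n" by (simp only: mult_less_cancel2)
  then have n: "2 \<le> n" by simp
  then have n0: "0 < n" by simp
  let ?G = "sym_group (m * k)" and ?B = "braid_group k" and ?M = "model_homs k m l"
  let ?f = "\<lambda>p. phi_hom k m l (t_family l p)"
  let ?R = "{(\<phi>, \<psi>). \<phi> \<in> ?M \<and> \<psi> \<in> ?M \<and> conj_homs ?B ?G \<phi> \<psi>}"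
  interpret G: group ?G by (rule sym_group_is_group)
  have psi: "braid_relations k ?G (psi_gen m)"
    using braid_relations_psi_gen[of m k] assms(2) by simp
  have phi: "braid_relations k ?G (phi_gen k m l t)" if "admissible k m l t" for t
    using braid_relations_phi_gen[OF n0 l] that unfolding m by blast
  have adm: "admissible k m l (t_family l p)" if "p < n" for p
    using admissible_t_family[OF l that] unfolding m .
  have hom: "?M \<subseteq> hom ?B ?G"
    using G.braid_hom_works(1)[OF psi] G.braid_hom_works(1)[OF phi]
    by (auto simp: model_homs_def psi_hom_def phi_hom_def)
  have equiv: "equiv ?M ?R" by (rule G.equiv_conj_homs[OF hom])
  have psi_phi: "\<not> conj_homs ?B ?G (psi_hom k m) (?f p)" if p: "p < n" for p
  proof
    assume "conj_homs ?B ?G (psi_hom k m) (?f p)"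
    then obtain h where h: "h permutes {1..m * k}"
      and "\<forall>i\<in>{1..<k}. psi_gen m i \<circ> h = h \<circ> phi_gen k m l (t_family l p) i"
      unfolding psi_hom_def phi_hom_def G.conj_homs_braid_hom_iff[OF psi phi[OF adm[OF p]]]
        sym_group_mult
      by (auto simp only: sym_group_carrier)
    then have "psi_gen m 1 \<circ> h = h \<circ> phi_gen k m l (t_family l p) 1" using assms(1) by simp
    then show False
      using psi_gen_phi_gen_not_conj[OF _ n l, of k h "t_family l p"] h assms(1) unfolding m by simp
  qed
  have phi_phi: "p = p'" if p: "p < n" "p' < n" and conj: "conj_homs ?B ?G (?f p) (?f p')" for p p'
  proof -
    obtain h where "h permutes {1..m * k}" "\<forall>i\<in>{1..<k}.
        phi_gen k m l (t_family l p) i \<circ> h = h \<circ> phi_gen k m l (t_family l p') i"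
      using conj
      unfolding phi_hom_def G.conj_homs_braid_hom_iff[OF phi[OF adm[OF p(1)]] phi[OF adm[OF p(2)]]]
        sym_group_mult
      by (auto simp only: sym_group_carrier)
    then show ?thesis
      using phi_gen_t_family_conj_imp_eq[OF assms(1) n0 l p, of h] unfolding m by blast
  qed
  have normal: "\<exists>p<n. conj_homs ?B ?G (phi_hom k m l t) (?f p)" if t: "admissible k m l t" for t
  proof -
    obtain p h where p: "p < n" and h: "h permutes {1..n * l * k}"
      "\<forall>i\<in>{1..<k}. phi_gen k (n * l) l t i \<circ> h = h \<circ> phi_gen k (n * l) l (t_family l p) i"
      using phi_gen_conj_t_family[OF n0 l] t unfolding m by blast
    have "conj_homs ?B ?G (phi_hom k m l t) (?f p)"
      unfolding phi_hom_def G.conj_homs_braid_hom_iff[OF phi[OF t] phi[OF adm[OF p]]]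
        sym_group_mult
      using h unfolding m by (auto simp only: sym_group_carrier)
    then show ?thesis using p by blast
  qed
  have refl: "conj_homs ?B ?G \<phi> \<phi>" if "\<phi> \<in> ?M" for \<phi>
    using equiv_class_self[OF equiv that] by simp
  have psi_M: "psi_hom k m \<in> ?M" by (simp add: model_homs_def)
  have f_M: "?f p \<in> ?M" if "p < n" for p using adm[OF that] by (auto simp: model_homs_def)
  have all: "conj_homs ?B ?G \<phi> (psi_hom k m) \<or> (\<exists>p<n. conj_homs ?B ?G \<phi> (?f p))" if "\<phi> \<in> ?M" for \<phi>
    using that refl[OF psi_M] normal unfolding model_homs_def by auto
  have "card (?M // ?R) = card (insert (psi_hom k m) (?f ` {..<n}))"
  proof (rule card_quotient_representatives[OF equiv])
    show "insert (psi_hom k m) (?f ` {..<n}) \<subseteq> ?M" using psi_M f_M by auto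
    show "\<exists>y\<in>insert (psi_hom k m) (?f ` {..<n}). (x, y) \<in> ?R" if "x \<in> ?M" for x
      using that all[OF that] psi_M f_M by auto
    fix x y assume x: "x \<in> insert (psi_hom k m) (?f ` {..<n})" and y: "y \<in> insert (psi_hom k m) (?f ` {..<n})"
      and R: "(x, y) \<in> ?R"
    \<comment> \<open>Both directions are taken because \<open>psi_phi\<close> has
      \<open>psi_hom\<close> on the left only.\<close>
    then have "conj_homs ?B ?G x y" "conj_homs ?B ?G y x"
      using equivE[OF equiv] by (auto dest: symD)
    then show "x = y" using x y psi_phi phi_phi by blast
  qed
  also have "\<dots> = Suc (card (?f ` {..<n}))"
  proof (rule card_insert_disjoint)
    show "psi_hom k m \<notin> ?f ` {..<n}"
    proof
      assume "psi_hom k m \<in> ?f ` {..<n}"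
      then obtain p where p: "p < n" "psi_hom k m = ?f p" by (elim imageE) simp
      show False using psi_phi[OF p(1)] refl[OF psi_M] unfolding p(2) by contradiction
    qed
  qed simp
  also have "card (?f ` {..<n}) = n"
  proof -
    have "inj_on ?f {..<n}"
    proof (rule inj_onI)
      fix p p' assume p: "p \<in> {..<n}" "p' \<in> {..<n}" and eq: "?f p = ?f p'"
      have "conj_homs ?B ?G (?f p) (?f p')" using refl[OF f_M] p unfolding eq[symmetric] by simp
      then show "p = p'" using phi_phi p by simp
    qed
    then show ?thesis by (simp add: card_image)
  qed
  finally have card: "card (?M // ?R) = n + 1" by simp
  have interval: "{1..k - 1} = {1..<k}" by auto
  \<comment> \<open>The left side is even, whatever value of \<open>min_mult\<close> stands for
    \<open>x\<close>.\<close>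
  have odd: "2 * l * x \<noteq> n" if "odd n" for x using that by auto
  show ?thesis
    unfolding n_def[symmetric] interval
  proof (intro conjI impI allI ballI)
    show "psi_hom k m \<in> hom ?B ?G"
      unfolding psi_hom_def by (rule G.braid_hom_works(1)[OF psi])
    show "psi_hom k m (braid_gen k i) = psi_gen m i" if "i \<in> {1..<k}" for i
      unfolding psi_hom_def by (rule G.braid_hom_works(3)[OF psi that])
    show "phi_hom k m l t \<in> hom ?B ?G" if "admissible k m l t" for t
      unfolding phi_hom_def by (rule G.braid_hom_works(1)[OF phi[OF that]])
    show "phi_hom k m l t (braid_gen k i) = phi_gen k m l t i"
      if "admissible k m l t" "i \<in> {1..<k}" for t i
      unfolding phi_hom_def by (rule G.braid_hom_works(3)[OF phi[OF that(1)] that(2)])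
  qed (use card adm psi_phi phi_phi all odd in blast)+
qed

end
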